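(* Let $\mathfrak g$ be an affine Kac--Moody algebra not of type $A_{2n}^{(2)}$, let $\ell\ge0$ be an integer, and let $\Lambda=(\ell-1)\Lambda_0+\Lambda_i$ be a distinguished representative of level $\ell$, i.e. $i\in J_{\mathfrak g}$ (with $\ell\ge1$ if $i\neq0$). Let $P^+_{\mathrm{cl},\ell}(\Lambda)$ be the equivalence class of $\Lambda$ in $P^+_{\mathrm{cl},\ell}$ under the sieving equivalence relation, and let $\mathrm{ev}_S$ be the $S$-evaluation. Then $$P^+_{\mathrm{cl},\ell}(\Lambda)=\{\Lambda'\in P^+_{\mathrm{cl},\ell} : \mathrm{ev}_S(\Lambda')\equiv \mathrm{ev}_S(\Lambda)\pmod{\mathsf N}\},$$ the congruence being componentwise when $\mathrm{ev}_S$ has two components.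
   Context: Let $I=\{0,\dots,n\}$, with simple roots $\alpha_i$, simple coroots $h_i$, fundamental weights $\Lambda_i$, affine Cartan matrix $(\mathsf a_{ij})$, $\langle h_i,\alpha_j\rangle=\mathsf a_{ij}$, $\langle h_j,\Lambda_i\rangle=\delta_{ij}$, null root $\delta=\sum a_i\alpha_i$, canonical central element $c=\sum a_i^\vee h_i$, root lattice $Q=\bigoplus\mathbb Z\alpha_i$. $P^+_{\mathrm{cl},\ell}=\{\sum_{i\in I} m_i\Lambda_i:m_i\in\mathbb Z_{\ge0},\sum a_i^\vee m_i=\ell\}$. The symmetric form on $\mathfrak h^*$ satisfies $(\Lambda_0|\Lambda_0)=0$, $(\alpha_i|\alpha_j)=a_i^\vee a_i^{-1}\mathsf a_{ij}$, $(\alpha_i|\Lambda_0)=\delta_{i0}a_0^{-1}$. The orthogonal projection $\mathfrak h^*\to\mathfrak h_0^*$ is $\overline\mu=\mu-\langle c,\mu\rangle\Lambda_0-(\mu|\Lambda_0)\delta$; $\overline Q$ is the image of $Q$. With $\theta=\delta-a_0\alpha_0$, put $\ell\mathcal C_{\mathrm{af}}=\{\mu\in\mathfrak h_0^*:\langle h_i,\mu\rangle\ge0\ (1\le i\le n),\ (\mu|\theta)\le\ell\}$. The sieving equivalence relation is: $\Lambda\sim\Lambda'$ iff $\ell\mathcal C_{\mathrm{af}}\cap(\overline\Lambda+\overline Q)=\ell\mathcal C_{\mathrm{af}}\cap(\overline{\Lambda'}+\overline Q)$. $\mathsf N=|P_0/Q_0|$ with $P_0,Q_0$ the weight and root lattices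 of the finite-dimensional subalgebra $\mathfrak g_0$ (delete index $0$): $\mathsf N=n+1$ for $A_n^{(1)}$; $2$ for $B_n^{(1)},C_n^{(1)},A_{2n-1}^{(2)},D_{n+1}^{(2)},E_7^{(1)}$; $4$ for $D_n^{(1)}$; $3$ for $E_6^{(1)}$; $1$ otherwise. Labelling is standard (Kac), with Bourbaki labelling of $\mathfrak g_0$ for $E_6$ ($0$ attached to $2$) and $E_7$ ($0$ attached to $1$); $\mathfrak g_0$ is $B_n$ for $B_n^{(1)},D_{n+1}^{(2)}$ and $C_n$ for $C_n^{(1)},A_{2n-1}^{(2)}$. Root sieving set $S\subset\mathbb Z^n$: $\{(1,2,\dots,n)\}$ for $A_n^{(1)}$; $\{(0,\dots,0,1)\}$ for $B_n^{(1)},D_{n+1}^{(2)}$; $\{(s_1,\dots,s_n)\}$ with $s_j=1$ for odd $j$, $0$ for even $j$, for $C_n^{(1)},A_{2n-1}^{(2)}$; for $D_n^{(1)}$ with $n$ odd, $\{(2,0,2,0,\dots,0,2,1,3)\}$ ($s_j=2$ for odd $j\le n-2$, $0$ for even $j\le n-3$, $s_{n-1}=1,s_n=3$); for $D_n^{(1)}$ with $n$ even, $\{s^{(1)},s^{(2)}\}$ with $s^{(1)}=(0,\dots,0,2,2)$, $s^{(2)}=(2,0,2,0,\dots,2,0,2,0)$; $\{(1,0,2,0,1,2)\}$ for $E_6^{(1)}$; $\{(0,1,0,0,1,0,1)\}$ for $E_7^{(1)}$; $\{(0,\dots,0)\}$ for the remaining types. The $S$-evaluation is $\mathrm{ev}_S(\sum_{i=0}^nm_i\Lambda_i)=\sum_{i=1}^ns_im_i$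 if $S=\{(s_1,\dots,s_n)\}$, and $\mathrm{ev}_S(\sum m_i\Lambda_i)=(\sum_{i=1}^n s^{(1)}_im_i,\ \sum_{i=1}^n s^{(2)}_im_i)$ for $D_n^{(1)}$ with $n$ even. Index sets: $J_{\mathfrak g}=\{0,\dots,n\}$ for $A_n^{(1)}$; $\{0,n\}$ for $B_n^{(1)},D_{n+1}^{(2)},E_7^{(1)}$; $\{0,1\}$ for $C_n^{(1)},A_{2n-1}^{(2)}$; $\{0,1,n-1,n\}$ for $D_n^{(1)}$; $\{0,1,6\}$ for $E_6^{(1)}$; $\{0\}$ for the remaining types. *)

theory Defs
  imports "HOL-Analysis.Linear_Algebra" "HOL-Number_Theory.Cong"
begin

text \<open>
  Affine types, with the numerical parameter of the constructors always being the \<open>n\<close> for which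
  the index set is \<open>{0..n}\<close>:
  \<open>Aff_A n, Aff_B n, Aff_C n, Aff_D n\<close> and \<open>Aff_E6, ..., Aff_G2\<close> are the untwisted types,
  \<open>Tw_A_even n\<close> is $A_{2n}^{(2)}$, \<open>Tw_A_odd n\<close> is $A_{2n-1}^{(2)}$, \<open>Tw_D n\<close> is $D_{n+1}^{(2)}$,
  \<open>Tw_E6\<close> is $E_6^{(2)}$ and \<open>Tw_D4\<close> is $D_4^{(3)}$.
\<close>

datatype affine_type =
    Aff_A nat | Aff_B nat | Aff_C nat | Aff_D nat
  | Aff_E6 | Aff_E7 | Aff_E8 | Aff_F4 | Aff_G2
  | Tw_A_even nat | Tw_A_odd nat | Tw_D nat | Tw_E6 | Tw_D4

fun rank :: "affine_type \<Rightarrow> nat" where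
  "rank (Aff_A n) = n"
| "rank (Aff_B n) = n"
| "rank (Aff_C n) = n"
| "rank (Aff_D n) = n"
| "rank Aff_E6 = 6"
| "rank Aff_E7 = 7"
| "rank Aff_E8 = 8"
| "rank Aff_F4 = 4"
| "rank Aff_G2 = 2"
| "rank (Tw_A_even n) = n"
| "rank (Tw_A_odd n) = n"
| "rank (Tw_D n) = n"
| "rank Tw_E6 = 4"
| "rank Tw_D4 = 2"

fun valid_type :: "affine_type \<Rightarrow> bool" where
  "valid_type (Aff_A n) \<longleftrightarrow> 1 \<le> n"
| "valid_type (Aff_B n) \<longleftrightarrow> 3 \<le> n"
| "valid_type (Aff_C n) \<longleftrightarrow> 2 \<le> n"
| "valid_type (Aff_D n) \<longleftrightarrow> 4 \<le> n"
| "valid_type (Tw_A_even n) \<longleftrightarrow> 1 \<le> n"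
| "valid_type (Tw_A_odd n) \<longleftrightarrow> 3 \<le> n"
| "valid_type (Tw_D n) \<longleftrightarrow> 2 \<le> n"
| "valid_type _ \<longleftrightarrow> True"

text \<open>
  Edges of the Dynkin diagram, each listed in one direction only. The labelling is that of Kac,
  except that $E_6^{(1)}$ and $E_7^{(1)}$ extend the Bourbaki labelling of $E_6$ and $E_7$.
\<close>

fun edges :: "affine_type \<Rightarrow> (nat \<times> nat) set" where
  "edges (Aff_A n) = {(i, i + 1) | i. i < n} \<union> {(0, n)}"
| "edges (Aff_B n) = {(0, 2)} \<union> {(i, i + 1) | i. 1 \<le> i \<and> i < n}"
| "edges (Aff_C n) = {(i, i + 1) | i. i < n}"
| "edges (Aff_D n) = {(0, 2), (n - 2, n)} \<union> {(i, i + 1) | i. 1 \<le> i \<and> i < n - 1}"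
| "edges Aff_E6 = {(1, 3), (3, 4), (4, 5), (5, 6), (2, 4), (0, 2)}"
| "edges Aff_E7 = {(0, 1), (1, 3), (3, 4), (4, 5), (5, 6), (6, 7), (2, 4)}"
| "edges Aff_E8 = {(0, 1), (1, 2), (2, 3), (3, 4), (4, 5), (5, 6), (6, 7), (5, 8)}"
| "edges Aff_F4 = {(0, 1), (1, 2), (2, 3), (3, 4)}"
| "edges Aff_G2 = {(0, 1), (1, 2)}"
| "edges (Tw_A_even n) = {(i, i + 1) | i. i < n}"
| "edges (Tw_A_odd n) = {(0, 2)} \<union> {(i, i + 1) | i. 1 \<le> i \<and> i < n}"
| "edges (Tw_D n) = {(i, i + 1) | i. i < n}"
| "edges Tw_E6 = {(0, 1), (1, 2), (2, 3), (3, 4)}"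
| "edges Tw_D4 = {(0, 1), (1, 2)}"

text \<open>
  For adjacent \<open>i\<close> and \<open>j\<close>, \<open>bond X i j\<close> is \<open>\<bar>\<langle>h\<^sub>i, \<alpha>\<^sub>j\<rangle>\<bar>\<close>; it exceeds 1 exactly if \<open>\<alpha>\<^sub>j\<close> is
  longer than \<open>\<alpha>\<^sub>i\<close>, or in the type $A_1^{(1)}$.
\<close>

fun bond :: "affine_type \<Rightarrow> nat \<Rightarrow> nat \<Rightarrow> int" where
  "bond (Aff_A n) i j = (if n = 1 then 2 else 1)"
| "bond (Aff_B n) i j = (if (i, j) = (n, n - 1) then 2 else 1)"
| "bond (Aff_C n) i j = (if (i, j) \<in> {(1, 0), (n - 1, n)} then 2 else 1)"
| "bond Aff_F4 i j = (if (i, j) = (3, 2) then 2 else 1)"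
| "bond Aff_G2 i j = (if (i, j) = (2, 1) then 3 else 1)"
| "bond (Tw_A_even n) i j =
     (if n = 1 then (if (i, j) = (0, 1) then 4 else 1)
      else if (i, j) \<in> {(0, 1), (n - 1, n)} then 2 else 1)"
| "bond (Tw_A_odd n) i j = (if (i, j) = (n - 1, n) then 2 else 1)"
| "bond (Tw_D n) i j = (if (i, j) \<in> {(0, 1), (n, n - 1)} then 2 else 1)"
| "bond Tw_E6 i j = (if (i, j) = (2, 3) then 2 else 1)"
| "bond Tw_D4 i j = (if (i, j) = (1, 2) then 3 else 1)"
| "bond _ i j = 1"

definition cartan :: "affine_type \<Rightarrow> nat \<Rightarrow> nat \<Rightarrow> int" where
  "cartan X i j =
     (if i = j then 2
      else if (i, j) \<in> edges X \<or> (j, i) \<in> edges X then - bond X i j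
      else 0)"

text \<open>
  The numerical labels of an affine matrix: the coprime positive integers \<open>a\<^sub>0, \<dots>, a\<^sub>n\<close> (unique by
  the theory of affine matrices) that form a vector in the kernel.
\<close>

definition numerical_labels :: "nat \<Rightarrow> (nat \<Rightarrow> nat \<Rightarrow> int) \<Rightarrow> (nat \<Rightarrow> nat) \<Rightarrow> bool" where
  "numerical_labels n A a \<longleftrightarrow>
     (\<forall>i\<le>n. 0 < a i) \<and> Gcd (a ` {..n}) = 1 \<and> (\<forall>i\<le>n. (\<Sum>j\<le>n. A i j * int (a j)) = 0)"

text \<open>
  The data that an affine Kac--Moody algebra of a given type induces on its Cartan subalgebra:
  \<open>'h\<close> is (the real form of) the Cartan subalgebra and \<open>'d\<close> its dual, paired by \<open>pair\<close>.
\<close>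

record ('h, 'd) affine_datum =
  atype :: affine_type
  pair :: "'h \<Rightarrow> 'd \<Rightarrow> real"
  coroot :: "nat \<Rightarrow> 'h"
  root :: "nat \<Rightarrow> 'd"
  fweight :: "nat \<Rightarrow> 'd"
  mark :: "nat \<Rightarrow> nat"
  comark :: "nat \<Rightarrow> nat"
  form :: "'d \<Rightarrow> 'd \<Rightarrow> real"

abbreviation rk :: "('h, 'd) affine_datum \<Rightarrow> nat" where
  "rk D \<equiv> rank (atype D)"

text \<open>
  The fundamental weights are only determined modulo multiples of the null root; the orthogonal
  projection below, and hence the sieving equivalence, is insensitive to this choice.
\<close>

definition is_affine_datum :: "('h::real_vector, 'd::real_vector) affine_datum \<Rightarrow> bool" where
  "is_affine_datum D \<longleftrightarrow>
     valid_type (atype D) \<and>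
     \<comment> \<open>a perfect pairing of \<open>(n + 2)\<close>-dimensional spaces\<close>
     dim (UNIV :: 'h set) = rk D + 2 \<and> dim (UNIV :: 'd set) = rk D + 2 \<and>
     bilinear (pair D) \<and>
     (\<forall>x. (\<forall>\<mu>. pair D x \<mu> = 0) \<longrightarrow> x = 0) \<and>
     (\<forall>\<mu>. (\<forall>x. pair D x \<mu> = 0) \<longrightarrow> \<mu> = 0) \<and>
     \<comment> \<open>a realization of the affine Cartan matrix\<close>
     inj_on (coroot D) {..rk D} \<and> independent (coroot D ` {..rk D}) \<and>
     inj_on (root D) {..rk D} \<and> independent (root D ` {..rk D}) \<and>
     (\<forall>i\<le>rk D. \<forall>j\<le>rk D. pair D (coroot D i) (root D j) = of_int (cartan (atype D) i j)) \<and>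
     (\<forall>i\<le>rk D. \<forall>j\<le>rk D. pair D (coroot D j) (fweight D i) = (if i = j then 1 else 0)) \<and>
     numerical_labels (rk D) (cartan (atype D)) (mark D) \<and>
     numerical_labels (rk D) (\<lambda>i j. cartan (atype D) j i) (comark D) \<and>
     \<comment> \<open>the normalized symmetric form\<close>
     bilinear (form D) \<and> (\<forall>\<mu> \<nu>. form D \<mu> \<nu> = form D \<nu> \<mu>) \<and>
     form D (fweight D 0) (fweight D 0) = 0 \<and>
     (\<forall>i\<le>rk D. \<forall>j\<le>rk D. form D (root D i) (root D j) =
        of_nat (comark D i) / of_nat (mark D i) * of_int (cartan (atype D) i j)) \<and>
     (\<forall>i\<le>rk D. form D (root D i) (fweight D 0) = (if i = 0 then 1 / of_nat (mark D 0) else 0))"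

definition null_root :: "('h, 'd::real_vector) affine_datum \<Rightarrow> 'd" where
  "null_root D = (\<Sum>i\<le>rk D. of_nat (mark D i) *\<^sub>R root D i)"

definition central :: "('h::real_vector, 'd) affine_datum \<Rightarrow> 'h" where
  "central D = (\<Sum>i\<le>rk D. of_nat (comark D i) *\<^sub>R coroot D i)"

definition theta :: "('h, 'd::real_vector) affine_datum \<Rightarrow> 'd" where
  "theta D = null_root D - of_nat (mark D 0) *\<^sub>R root D 0"

definition root_lattice :: "('h, 'd::real_vector) affine_datum \<Rightarrow> 'd set" where
  "root_lattice D = {\<Sum>i\<le>rk D. of_int (k i) *\<^sub>R root D i | k :: nat \<Rightarrow> int. True}"

definition dominant_level :: "('h, 'd::real_vector) affine_datum \<Rightarrow> nat \<Rightarrow> 'd set" where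
  "dominant_level D l =
     {\<Sum>i\<le>rk D. of_nat (m i) *\<^sub>R fweight D i | m :: nat \<Rightarrow> nat. (\<Sum>i\<le>rk D. comark D i * m i) = l}"

definition finite_dual :: "('h, 'd::real_vector) affine_datum \<Rightarrow> 'd set" where
  "finite_dual D = span (root D ` {1..rk D})"

definition finite_weight_lattice :: "('h, 'd::real_vector) affine_datum \<Rightarrow> 'd set" where
  "finite_weight_lattice D = {\<mu> \<in> finite_dual D. \<forall>i\<in>{1..rk D}. pair D (coroot D i) \<mu> \<in> \<int>}"

definition finite_root_lattice :: "('h, 'd::real_vector) affine_datum \<Rightarrow> 'd set" where
  "finite_root_lattice D = {\<Sum>i=1..rk D. of_int (k i) *\<^sub>R root D i | k :: nat \<Rightarrow> int. True}"

definition fundamental_index :: "('h, 'd::real_vector) affine_datum \<Rightarrow> nat" where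
  "fundamental_index D =
     card (finite_weight_lattice D //
       {(\<mu>, \<nu>). \<mu> \<in> finite_weight_lattice D \<and> \<nu> \<in> finite_weight_lattice D \<and>
                 \<mu> - \<nu> \<in> finite_root_lattice D})"

definition proj :: "('h::real_vector, 'd::real_vector) affine_datum \<Rightarrow> 'd \<Rightarrow> 'd" where
  "proj D \<mu> = \<mu> - pair D (central D) \<mu> *\<^sub>R fweight D 0 - form D \<mu> (fweight D 0) *\<^sub>R null_root D"

definition alcove :: "('h, 'd::real_vector) affine_datum \<Rightarrow> nat \<Rightarrow> 'd set" where
  "alcove D l =
     {\<mu> \<in> finite_dual D. (\<forall>i\<in>{1..rk D}. 0 \<le> pair D (coroot D i) \<mu>) \<and> form D \<mu> (theta D) \<le> of_nat l}"

definition sieving_equiv ::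
    "('h::real_vector, 'd::real_vector) affine_datum \<Rightarrow> nat \<Rightarrow> 'd \<Rightarrow> 'd \<Rightarrow> bool" where
  "sieving_equiv D l \<mu> \<nu> \<longleftrightarrow>
     alcove D l \<inter> {proj D \<mu> + \<beta> | \<beta>. \<beta> \<in> proj D ` root_lattice D} =
     alcove D l \<inter> {proj D \<nu> + \<beta> | \<beta>. \<beta> \<in> proj D ` root_lattice D}"

definition sieving_class ::
    "('h::real_vector, 'd::real_vector) affine_datum \<Rightarrow> nat \<Rightarrow> 'd \<Rightarrow> 'd set" where
  "sieving_class D l \<mu> = {\<nu> \<in> dominant_level D l. sieving_equiv D l \<mu> \<nu>}"

text \<open>
  The root sieving set, as the list of its vectors \<open>(s\<^sub>1, \<dots>, s\<^sub>n)\<close>; only the values at \<open>1, \<dots>, n\<close>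
  matter.
\<close>

fun sieving_set :: "affine_type \<Rightarrow> (nat \<Rightarrow> int) list" where
  "sieving_set (Aff_A n) = [\<lambda>j. int j]"
| "sieving_set (Aff_B n) = [\<lambda>j. if j = n then 1 else 0]"
| "sieving_set (Tw_D n) = [\<lambda>j. if j = n then 1 else 0]"
| "sieving_set (Aff_C n) = [\<lambda>j. if odd j then 1 else 0]"
| "sieving_set (Tw_A_odd n) = [\<lambda>j. if odd j then 1 else 0]"
| "sieving_set (Aff_D n) =
     (if odd n
      then [\<lambda>j. if j = n then 3 else if j = n - 1 then 1 else if odd j then 2 else 0]
      else [\<lambda>j. if j = n - 1 \<or> j = n then 2 else 0, \<lambda>j. if odd j then 2 else 0])"
| "sieving_set Aff_E6 = [\<lambda>j. [1, 0, 2, 0, 1, 2] ! (j - 1)]"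
| "sieving_set Aff_E7 = [\<lambda>j. [0, 1, 0, 0, 1, 0, 1] ! (j - 1)]"
| "sieving_set _ = [\<lambda>j. 0]"

text \<open>
  The components of the $S$-evaluation. For \<open>\<mu> = (\<Sum>i\<le>n. m\<^sub>i \<Lambda>\<^sub>i)\<close> with integers \<open>m\<^sub>i\<close>, the
  coefficient \<open>m\<^sub>i\<close> is \<open>\<langle>h\<^sub>i, \<mu>\<rangle>\<close>; the floor merely turns this real number into an integer.
\<close>

definition ev_S :: "('h, 'd) affine_datum \<Rightarrow> 'd \<Rightarrow> int list" where
  "ev_S D \<mu> = map (\<lambda>s. \<Sum>i=1..rk D. s i * \<lfloor>pair D (coroot D i) \<mu>\<rfloor>) (sieving_set (atype D))"

fun distinguished_indices :: "affine_type \<Rightarrow> nat set" where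
  "distinguished_indices (Aff_A n) = {0..n}"
| "distinguished_indices (Aff_B n) = {0, n}"
| "distinguished_indices (Tw_D n) = {0, n}"
| "distinguished_indices Aff_E7 = {0, 7}"
| "distinguished_indices (Aff_C n) = {0, 1}"
| "distinguished_indices (Tw_A_odd n) = {0, 1}"
| "distinguished_indices (Aff_D n) = {0, 1, n - 1, n}"
| "distinguished_indices Aff_E6 = {0, 1, 6}"
| "distinguished_indices _ = {0}"

end

theory Submission
  imports Defs
begin

text \<open>
  The projection kills \<open>\<Lambda>\<^sub>0\<close>, fixes \<open>\<alpha>\<^sub>1, \<dots>, \<alpha>\<^sub>n\<close> and sends \<open>\<alpha>\<^sub>0\<close> to \<open>-\<theta>\<close>, since the labels \<open>a\<^sub>0\<close> and \<open>a\<^sub>0\<^sup>\<or>\<close>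
  are 1 outside $A_{2n}^{(2)}$. Hence it maps \<open>Q\<close> onto the finite root lattice \<open>Q\<^sub>0\<close>, and it maps dominant
  weights of level \<open>l\<close> into the alcove. Consequently two dominant weights are equivalent iff their
  projections differ by an element of \<open>Q\<^sub>0\<close>. In the coordinates \<open>k\<^sub>i = \<langle>h\<^sub>i, \<mu>\<rangle>\<close> the lattice \<open>Q\<^sub>0\<close> is the image
  of the finite Cartan matrix, and a case analysis shows that this image is cut out by the
  congruences \<open>\<Sum>s\<^sub>i k\<^sub>i \<equiv> 0\<close> modulo \<open>N\<close> for \<open>s\<close> in the sieving set. The values of these sums modulo \<open>N\<close>
  therefore parametrise the quotient of the lattices, whose order is \<open>N\<close>.
\<close>

section \<open>Rows of the affine Cartan matrices\<close>

abbreviation affine_row :: "affine_type \<Rightarrow> (nat \<Rightarrow> int) \<Rightarrow> nat \<Rightarrow> int" where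
  "affine_row X f i \<equiv> \<Sum>j\<le>rank X. cartan X i j * f j"

definition neighbours :: "affine_type \<Rightarrow> nat \<Rightarrow> nat set" where
  "neighbours X i = {j. j \<le> rank X \<and> j \<noteq> i \<and> ((i, j) \<in> edges X \<or> (j, i) \<in> edges X)}"

lemma affine_row_neighbours:
  assumes "i \<le> rank X"
  shows "affine_row X f i = 2 * f i - (\<Sum>j\<in>neighbours X i. bond X i j * f j)"
proof -
  have "affine_row X f i = cartan X i i * f i + (\<Sum>j\<in>{..rank X} - {i}. cartan X i j * f j)"
    using assms by (subst sum.remove[of _ i]) auto
  also have "(\<Sum>j\<in>{..rank X} - {i}. cartan X i j * f j)
      = (\<Sum>j\<in>neighbours X i. cartan X i j * f j)"
    by (rule sum.mono_neutral_right) (auto simp: neighbours_def cartan_def)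
  also have "\<dots> = (\<Sum>j\<in>neighbours X i. - (bond X i j * f j))"
    by (rule sum.cong) (auto simp: neighbours_def cartan_def)
  finally show ?thesis by (simp add: cartan_def sum_negf)
qed

lemma affine_row_A:
  assumes "1 \<le> n" "i \<le> n"
  shows "affine_row (Aff_A n) f i =
    (if i = 0 then 2 * f 0 - f 1 - f n else if i = n then 2 * f n - f (n - 1) - f 0
     else 2 * f i - f (i - 1) - f (i + 1))"
\<comment> \<open>For A_1^{(1)} the two neighbours of a node coincide; the bond 2 then stands for
  the two separate terms of the formula.\<close>
proof (cases "n = 1")
  case True
  then have "neighbours (Aff_A n) i = {1 - i}"
    using assms by (cases "i = 0") (auto simp: neighbours_def)
  moreover have "i = 0 \<or> i = 1" using True assms by auto
  ultimately show ?thesis using True affine_row_neighbours[of i "Aff_A n" f] by auto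
next
  case False
  then have "neighbours (Aff_A n) i = (if i = 0 then {1, n} else if i = n then {n - 1, 0} else {i - 1, i + 1})"
    using assms by (auto simp: neighbours_def)
  then show ?thesis using False assms affine_row_neighbours[of i "Aff_A n" f] by auto
qed

lemma affine_row_B:
  assumes "3 \<le> n" "i \<le> n"
  shows "affine_row (Aff_B n) f i =
    (if i \<le> 1 then 2 * f i - f 2 else if i = 2 then 2 * f 2 - f 0 - f 1 - f 3
     else if i = n then 2 * f n - 2 * f (n - 1) else 2 * f i - f (i - 1) - f (i + 1))"
proof -
  have "neighbours (Aff_B n) i = (if i \<le> 1 then {2} else if i = 2 then {0, 1, 3}
      else if i = n then {n - 1} else {i - 1, i + 1})"
    using assms by (auto simp: neighbours_def)
  then show ?thesis using assms affine_row_neighbours[of i "Aff_B n" f] by auto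
qed

lemma affine_row_Tw_A_odd:
  assumes "3 \<le> n" "i \<le> n"
  shows "affine_row (Tw_A_odd n) f i =
    (if i \<le> 1 then 2 * f i - f 2
     else if i = 2 then 2 * f 2 - f 0 - f 1 - (if n = 3 then 2 else 1) * f 3
     else if i = n then 2 * f n - f (n - 1)
     else 2 * f i - f (i - 1) - (if i = n - 1 then 2 else 1) * f (i + 1))"
proof -
  have "neighbours (Tw_A_odd n) i = (if i \<le> 1 then {2} else if i = 2 then {0, 1, 3}
      else if i = n then {n - 1} else {i - 1, i + 1})"
    using assms by (auto simp: neighbours_def)
  then show ?thesis using assms affine_row_neighbours[of i "Tw_A_odd n" f] by auto
qed

lemma affine_row_C:
  assumes "2 \<le> n" "i \<le> n"
  shows "affine_row (Aff_C n) f i =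
    (if i = 0 then 2 * f 0 - f 1 else if i = n then 2 * f n - f (n - 1)
     else 2 * f i - (if i = 1 then 2 else 1) * f (i - 1) - (if i = n - 1 then 2 else 1) * f (i + 1))"
proof -
  have "neighbours (Aff_C n) i = (if i = 0 then {1} else if i = n then {n - 1} else {i - 1, i + 1})"
    using assms by (auto simp: neighbours_def)
  then show ?thesis using assms affine_row_neighbours[of i "Aff_C n" f] by auto
qed

lemma affine_row_Tw_D:
  assumes "2 \<le> n" "i \<le> n"
  shows "affine_row (Tw_D n) f i =
    (if i = 0 then 2 * f 0 - 2 * f 1 else if i = n then 2 * f n - 2 * f (n - 1)
     else 2 * f i - f (i - 1) - f (i + 1))"
proof -
  have "neighbours (Tw_D n) i = (if i = 0 then {1} else if i = n then {n - 1} else {i - 1, i + 1})"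
    using assms by (auto simp: neighbours_def)
  then show ?thesis using assms affine_row_neighbours[of i "Tw_D n" f] by auto
qed

text \<open>With rank \<open>m + 4\<close>, the nodes at the far end are named without truncated
  subtraction. The branch nodes 2 and \<open>m + 2\<close> coincide for D_4^{(1)}, so their extra
  terms are independent conditionals that may both apply.\<close>

lemma affine_row_D:
  assumes "i \<le> m + 4"
  shows "affine_row (Aff_D (m + 4)) f i = 2 * f i -
    (if i \<le> 1 then f 2 else if m + 3 \<le> i then f (m + 2)
     else (if i = 2 then f 0 else 0) + (if i = m + 2 then f (m + 4) else 0) + f (i - 1) + f (i + 1))"
proof -
  let ?end0 = "if i = 2 then {0} else {}" and ?end1 = "if i = m + 2 then {m + 4} else {}"
  consider "i = 0" | "i = 1" | k where "i = k + 2" "k \<le> m" | "i = m + 3" | "i = m + 4"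
  proof (cases "i < 2 \<or> m + 2 < i")
    case True
    then show ?thesis using that assms by fastforce
  next
    case False
    then have "i = (i - 2) + 2" "i - 2 \<le> m" by auto
    then show ?thesis by (rule that(3))
  qed
  then show ?thesis
  proof cases
    case (3 k)
    have "neighbours (Aff_D (m + 4)) i = (?end0 \<union> ?end1) \<union> {i - 1, i + 1}"
      unfolding 3 using 3 by (auto simp: neighbours_def)
    then show ?thesis using 3 affine_row_neighbours[of i "Aff_D (m + 4)" f] by auto
  next
    case 1
    then have "neighbours (Aff_D (m + 4)) i = {2}" by (auto simp: neighbours_def)
    then show ?thesis using 1 affine_row_neighbours[of i "Aff_D (m + 4)" f] by simp
  next
    case 2
    then have "neighbours (Aff_D (m + 4)) i = {2}" by (auto simp: neighbours_def)
    then show ?thesis using 2 affine_row_neighbours[of i "Aff_D (m + 4)" f] by simp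
  next
    case 4
    then have "neighbours (Aff_D (m + 4)) i = {m + 2}" by (auto simp: neighbours_def)
    then show ?thesis using 4 affine_row_neighbours[of i "Aff_D (m + 4)" f] by simp
  next
    case 5
    then have "neighbours (Aff_D (m + 4)) i = {m + 2}" by (auto simp: neighbours_def)
    then show ?thesis using 5 affine_row_neighbours[of i "Aff_D (m + 4)" f] by simp
  qed
qed

text \<open>The type whose Cartan matrix is the transposed one, with the same labelling of the nodes.\<close>
fun dual_type :: "affine_type \<Rightarrow> affine_type" where
  "dual_type (Aff_B n) = Tw_A_odd n"
| "dual_type (Tw_A_odd n) = Aff_B n"
| "dual_type (Aff_C n) = Tw_D n"
| "dual_type (Tw_D n) = Aff_C n"
| "dual_type Aff_F4 = Tw_E6"
| "dual_type Tw_E6 = Aff_F4"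
| "dual_type Aff_G2 = Tw_D4"
| "dual_type Tw_D4 = Aff_G2"
| "dual_type X = X"

text \<open>Transposition reverses the arrows of the diagram: the edges stay and only the bonds
  change.\<close>

lemma cartan_dual_type:
  assumes "valid_type X" "\<forall>n. X \<noteq> Tw_A_even n"
  shows "cartan (dual_type X) i j = cartan X j i" "rank (dual_type X) = rank X"
proof -
  have "bond (dual_type X) i j = bond X j i" "edges (dual_type X) = edges X"
    using assms by (cases X; auto)+
  then show "cartan (dual_type X) i j = cartan X j i"
    by (auto simp: cartan_def)
  show "rank (dual_type X) = rank X"
    by (cases X) auto
qed

text \<open>Kac's tables of the labels a_i. A datum fixes its marks only as a coprime positive
  kernel vector; an explicit kernel vector with entry 1 at node 0 is what forces a_0 = 1. The last
  clause is a filler for A_{2n}^{(2)}.\<close>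

fun kac_label :: "affine_type \<Rightarrow> nat \<Rightarrow> int" where
  "kac_label (Aff_A n) i = 1"
| "kac_label (Aff_B n) i = (if i \<le> 1 then 1 else 2)"
| "kac_label (Aff_C n) i = (if i = 0 \<or> i = n then 1 else 2)"
| "kac_label (Aff_D n) i = (if i \<le> 1 \<or> n - 1 \<le> i then 1 else 2)"
| "kac_label Aff_E6 i = [1, 1, 2, 2, 3, 2, 1] ! i"
| "kac_label Aff_E7 i = [1, 2, 2, 3, 4, 3, 2, 1] ! i"
| "kac_label Aff_E8 i = [1, 2, 3, 4, 5, 6, 4, 2, 3] ! i"
| "kac_label Aff_F4 i = [1, 2, 3, 4, 2] ! i"
| "kac_label Aff_G2 i = [1, 2, 3] ! i"
| "kac_label (Tw_A_odd n) i = (if i \<le> 1 \<or> i = n then 1 else 2)"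
| "kac_label (Tw_D n) i = 1"
| "kac_label Tw_E6 i = [1, 2, 3, 2, 1] ! i"
| "kac_label Tw_D4 i = [1, 2, 1] ! i"
| "kac_label _ i = 0"

lemma affine_row_kac_label:
  assumes "valid_type X" "\<forall>n. X \<noteq> Tw_A_even n" "i \<le> rank X"
  shows "affine_row X (kac_label X) i = 0"
proof (cases X)
  case (Aff_A n)
  then show ?thesis using assms affine_row_A[of n i "kac_label X"] by auto
next
  case (Aff_B n)
  then show ?thesis using assms affine_row_B[of n i "kac_label X"] by auto
next
  case (Aff_C n)
  then have n: "2 \<le> n" "i \<le> n" using assms by auto
  then consider "i = 0" | "i = 1" "n = 2" | "i = 1" "2 < n" | "1 < i" "i < n - 1" | "1 < i" "i = n - 1"
    | "1 < i" "i = n"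
    by linarith
  then show ?thesis
    using n unfolding Aff_C affine_row_C[OF n, of "kac_label (Aff_C n)"] by cases auto
next
  case (Aff_D n)
  moreover obtain m where "n = m + 4"
    using Aff_D assms by (metis valid_type.simps(4) le_add_diff_inverse2)
  ultimately show ?thesis using assms affine_row_D[of i m "kac_label X"] by auto
next
  case (Tw_A_odd n)
  then have n: "3 \<le> n" "i \<le> n" using assms by auto
  then consider "i \<le> 1" | "i = 2" "n = 3" | "i = 2" "3 < n" | "2 < i" "i < n - 1" | "2 < i" "i = n - 1"
    | "2 < i" "i = n"
    by linarith
  then show ?thesis
    using n unfolding Tw_A_odd affine_row_Tw_A_odd[OF n, of "kac_label (Tw_A_odd n)"] by cases auto
next
  case (Tw_D n)
  then show ?thesis using assms affine_row_Tw_D[of n i "kac_label X"] by auto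
next
  case Aff_E6
  have "i \<in> {0,1,2,3,4,5,6}" using assms Aff_E6 by auto
  then show ?thesis using Aff_E6 by (elim insertE) (simp_all add: cartan_def atMost_nat_numeral)
next
  case Aff_E7
  have "i \<in> {0,1,2,3,4,5,6,7}" using assms Aff_E7 by auto
  then show ?thesis using Aff_E7 by (elim insertE) (simp_all add: cartan_def atMost_nat_numeral)
next
  case Aff_E8
  have "i \<in> {0,1,2,3,4,5,6,7,8}" using assms Aff_E8 by auto
  then show ?thesis using Aff_E8 by (elim insertE) (simp_all add: cartan_def atMost_nat_numeral)
next
  case Aff_F4
  have "i \<in> {0,1,2,3,4}" using assms Aff_F4 by auto
  then show ?thesis using Aff_F4 by (elim insertE) (simp_all add: cartan_def atMost_nat_numeral)
next
  case Tw_E6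
  have "i \<in> {0,1,2,3,4}" using assms Tw_E6 by auto
  then show ?thesis using Tw_E6 by (elim insertE) (simp_all add: cartan_def atMost_nat_numeral)
next
  case Aff_G2
  have "i \<in> {0,1,2}" using assms Aff_G2 by auto
  then show ?thesis using Aff_G2 by (elim insertE) (simp_all add: cartan_def atMost_nat_numeral)
next
  case Tw_D4
  have "i \<in> {0,1,2}" using assms Tw_D4 by auto
  then show ?thesis using Tw_D4 by (elim insertE) (simp_all add: cartan_def atMost_nat_numeral)
qed (use assms in auto)


text \<open>The table of the orders |P_0/Q_0|, confirmed in \<open>fundamental_index_eq\<close>. The
  last clause covers B_n^{(1)}, C_n^{(1)}, E_7^{(1)}, A_{2n-1}^{(2)} and D_{n+1}^{(2)}.\<close>

fun weight_index :: "affine_type \<Rightarrow> nat" where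
  "weight_index (Aff_A n) = n + 1"
| "weight_index (Aff_D n) = 4"
| "weight_index Aff_E6 = 3"
| "weight_index Aff_E8 = 1"
| "weight_index Aff_F4 = 1"
| "weight_index Aff_G2 = 1"
| "weight_index Tw_E6 = 1"
| "weight_index Tw_D4 = 1"
| "weight_index _ = 2"

text \<open>Deleting node 0 amounts to giving it the value 0, so the affine row formulas also serve
  the finite Cartan matrix.\<close>

lemma finite_row_eq_affine_row:
  "(\<Sum>j=1..rank X. cartan X i j * f j) = affine_row X (f(0 := 0)) i"
proof -
  have "{..rank X} = insert 0 {1..rank X}" by auto
  then show ?thesis by simp
qed

section \<open>The image of the finite Cartan matrix\<close>

text \<open>Column \<open>j\<close> holds the coordinates of the simple root with index
  \<open>j\<close>. Testing it against \<open>s\<close> evaluates a row of the transposed matrix,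
  that is, of the dual type, where the row formulas apply.\<close>

lemma column_sum_divisible:
  assumes X: "valid_type X" "\<forall>n. X \<noteq> Tw_A_even n"
    and s: "s \<in> set (sieving_set X)" and j: "j \<in> {1..rank X}"
  shows "int (weight_index X) dvd (\<Sum>i=1..rank X. s i * cartan X i j)"
proof -
  have "(\<Sum>i=1..rank X. s i * cartan X i j)
      = (\<Sum>i=1..rank (dual_type X). cartan (dual_type X) j i * s i)"
    using cartan_dual_type[OF X] by (simp add: mult.commute)
  also have "\<dots> = affine_row (dual_type X) (s(0 := 0)) j"
    by (rule finite_row_eq_affine_row)
  also have "int (weight_index X) dvd \<dots>"
  proof (cases X)
    case (Aff_A n)
    then show ?thesis using X s j affine_row_A[of n j "s(0 := 0)"] by (auto simp: add.commute)
  next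
    case (Aff_B n)
    then consider "j = 1" | "j = 2" "n = 3" | "j = 2" "3 < n" | "2 < j" "j < n - 1" | "2 < j" "j = n - 1"
      | "2 < j" "j = n"
      using j X by fastforce
    then show ?thesis using Aff_B X s affine_row_Tw_A_odd[of n j "s(0 := 0)"] by cases auto
  next
    case (Aff_C n)
    then show ?thesis using X s j affine_row_Tw_D[of n j "s(0 := 0)"] by auto
  next
    case (Tw_A_odd n)
    then show ?thesis using X s j affine_row_B[of n j "s(0 := 0)"] by auto
  next
    case (Tw_D n)
    then show ?thesis using X s j affine_row_C[of n j "s(0 := 0)"] by auto
  next
    case (Aff_D n)
    then obtain m where m: "n = m + 4"
      using X by (metis valid_type.simps(4) le_add_diff_inverse2)
    obtain i where i: "j = i + 1" "i < m + 4" using j m Aff_D by (cases j) auto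
    have row: "affine_row X (s(0 := 0)) j = 2 * s j -
        (if i = 0 then s 2 else if m + 2 \<le> i then s (m + 2)
         else (if i = m + 1 then s (m + 4) else 0) + (s(0 := 0)) i + s (i + 2))"
      using affine_row_D[of j m "s(0 := 0)"] i m Aff_D by auto
    have X': "dual_type X = X" "weight_index X = 4" using Aff_D by auto
    consider "i = 0" | "0 < i" "i < m + 1" | "i = m + 1" | "i = m + 2" | "i = m + 3"
      using i by linarith
    then show ?thesis
      using s i unfolding X' row by cases (auto simp: m Aff_D split: if_splits)
  next
    case Aff_E6
    then have "j \<in> {1, 2, 3, 4, 5, 6}" using j by auto
    then show ?thesis using s Aff_E6
      by (elim insertE) (simp_all add: cartan_def atMost_nat_numeral)
  next
    case Aff_E7
    then have "j \<in> {1, 2, 3, 4, 5, 6, 7}" using j by auto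
    then show ?thesis using s Aff_E7
      by (elim insertE) (simp_all add: cartan_def atMost_nat_numeral)
  qed (use X s in auto)
  finally show ?thesis .
qed

section \<open>Integral preimages in the classical types\<close>

text \<open>
  The solution \<open>x\<close> of the inner equations \<open>k\<^sub>m = 2 x\<^sub>m - x\<^sub>m\<^sub>-\<^sub>1 - x\<^sub>m\<^sub>+\<^sub>1\<close> of a linear diagram with
  \<open>x\<^sub>0 = 0\<close> and \<open>x\<^sub>1 = c\<close>. In each classical type, the equations at the end of the diagram then
  determine \<open>c\<close>, and the sieving congruence is exactly what makes \<open>c\<close> and the last entries integral.
\<close>
primrec chain :: "int \<Rightarrow> (nat \<Rightarrow> int) \<Rightarrow> nat \<Rightarrow> int" where
  "chain c k 0 = 0"
| "chain c k (Suc m) = chain c k m + c - (\<Sum>j=1..m. k j)"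

lemma chain_row:
  "1 \<le> m \<Longrightarrow> 2 * chain c k m - chain c k (m - 1) - chain c k (m + 1) = k m"
  by (cases m) auto

text \<open>This exposes the weighted sum of \<open>j * k j\<close>, which is the value of the
  sieving vector of A_n^{(1)} and whose parity is recorded by that of C_n^{(1)}.\<close>

lemma chain_closed_form:
  "chain c k m = int m * (c - (\<Sum>j=1..m. k j)) + (\<Sum>j=1..m. int j * k j)"
  by (induction m) (auto simp: algebra_simps)

lemma even_sum_odd_entries_iff:
  "even (\<Sum>j=1..m. int j * k j) \<longleftrightarrow> even (\<Sum>j=1..m. if odd j then k j else 0)"
  by (induction m) auto

lemma root_coordinatesI:
  assumes "x 0 = 0" "n = rank X" "\<And>i. i \<in> {1..n} \<Longrightarrow> k i = affine_row X x i"
  shows "\<exists>x. \<forall>i\<in>{1..n}. k i = (\<Sum>j=1..n. cartan X i j * x j)"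
proof -
  have "x(0 := 0) = x" using assms(1) by auto
  then have "\<forall>i\<in>{1..n}. k i = (\<Sum>j=1..n. cartan X i j * x j)"
    using assms(2,3) finite_row_eq_affine_row[of X _ x] by simp
  then show ?thesis by blast
qed

lemma root_coordinates_A:
  assumes n: "1 \<le> n" and dvd: "int (n + 1) dvd (\<Sum>j=1..n. int j * k j)"
  shows "\<exists>x. \<forall>i\<in>{1..n}. k i = (\<Sum>j=1..n. cartan (Aff_A n) i j * x j)"
proof -
  obtain d where d: "(\<Sum>j=1..n. int j * k j) = int (n + 1) * d" using dvd by blast
  \<comment> \<open>The closed form becomes \<open>- n * d + (n + 1) * d = d\<close> at position
    \<open>n\<close>, and the next increment is \<open>- d\<close>. The chain thus returns to 0 at
    \<open>n + 1\<close>, where the cycle of A_n^{(1)} closes up at node 0.\<close>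
  define c where "c = (\<Sum>j=1..n. k j) - d"
  have "chain c k n = d"
    using d by (simp add: chain_closed_form c_def algebra_simps)
  then have "chain c k (n + 1) = 0" by (simp add: c_def)
  then have "k i = affine_row (Aff_A n) (chain c k) i" if "i \<in> {1..n}" for i
    using chain_row[of i c k] affine_row_A[of n i "chain c k"] n that by auto
  then show ?thesis by (intro root_coordinatesI[of "chain c k"]) auto
qed

lemma root_coordinates_B:
  assumes n: "3 \<le> n" and even: "even (k n)"
  shows "\<exists>x. \<forall>i\<in>{1..n}. k i = (\<Sum>j=1..n. cartan (Aff_B n) i j * x j)"
proof -
  \<comment> \<open>The last row is twice the increment from \<open>n - 1\<close> to
    \<open>n\<close>, so this increment has to be \<open>k n div 2\<close>.\<close>
  define c where "c = (\<Sum>j=1..n - 1. k j) + k n div 2"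
  have "2 * chain c k n - 2 * chain c k (n - 1) = k n"
    using n even by (cases n) (auto simp: c_def)
  moreover define x where "x = chain c k"
  ultimately have last: "2 * x n - 2 * x (n - 1) = k n" by simp
  have x0: "x 0 = 0" by (simp add: x_def)
  have row: "2 * x i - x (i - 1) - x (i + 1) = k i" if "1 \<le> i" for i
    using chain_row[OF that, of c k] by (simp add: x_def)
  have "k i = affine_row (Aff_B n) x i" if i: "i \<in> {1..n}" for i
  proof -
    consider "i = 1" | "i = 2" "i < n" | "2 < i" "i < n" | "i = n" using i n by fastforce
    then show ?thesis
      using n i x0 row[of i] last affine_row_B[of n i x]
      by cases (auto simp: numeral_2_eq_2 numeral_3_eq_3)
  qed
  then show ?thesis using x0 by (intro root_coordinatesI[of x]) auto
qed

lemma root_coordinates_Tw_D: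
  assumes n: "2 \<le> n" and even: "even (k n)"
  shows "\<exists>x. \<forall>i\<in>{1..n}. k i = (\<Sum>j=1..n. cartan (Tw_D n) i j * x j)"
proof -
  \<comment> \<open>The finite part is B_n again, hence the same initial value.\<close>
  define c where "c = (\<Sum>j=1..n - 1. k j) + k n div 2"
  have "2 * chain c k n - 2 * chain c k (n - 1) = k n"
    using n even by (cases n) (auto simp: c_def)
  moreover define x where "x = chain c k"
  ultimately have last: "2 * x n - 2 * x (n - 1) = k n" by simp
  have x0: "x 0 = 0" by (simp add: x_def)
  have row: "2 * x i - x (i - 1) - x (i + 1) = k i" if "1 \<le> i" for i
    using chain_row[OF that, of c k] by (simp add: x_def)
  have "k i = affine_row (Tw_D n) x i" if i: "i \<in> {1..n}" for i
  proof -
    consider "i < n" | "i = n" using i n by fastforce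
    then show ?thesis
      using n i x0 row[of i] last affine_row_Tw_D[of n i x]
      by cases (auto simp: numeral_2_eq_2 numeral_3_eq_3)
  qed
  then show ?thesis using x0 by (intro root_coordinatesI[of x]) auto
qed

text \<open>In C_n the last unknown enters row \<open>n - 1\<close> with coefficient 2. Its double
  therefore continues a plain chain, and the parity condition is what allows the last entry to be
  halved. Both types with finite part C_n use this.\<close>

lemma halved_chain:
  fixes k :: "nat \<Rightarrow> int"
  assumes n: "2 \<le> n" and even: "even (\<Sum>j=1..n. if odd j then k j else 0)"
  obtains x where "x 0 = 0" "2 * x n - x (n - 1) = k n"
    "2 * x (n - 1) - x (n - 2) - 2 * x n = k (n - 1)"
    "\<And>i. 1 \<le> i \<Longrightarrow> i < n - 1 \<Longrightarrow> 2 * x i - x (i - 1) - x (i + 1) = k i"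
proof -
  \<comment> \<open>This makes the last increment \<open>k n\<close>, as the last row demands, and
    reduces the closed form at \<open>n\<close> to the weighted sum of
    \<open>j * k j\<close>.\<close>
  define c where "c = (\<Sum>j=1..n. k j)"
  define x where "x = (chain c k)(n := chain c k n div 2)"
  have "even (chain c k n)"
    using even even_sum_odd_entries_iff[of k n] by (simp add: chain_closed_form c_def)
  then have xn: "2 * x n = chain c k n" by (simp add: x_def)
  have "chain c k n - chain c k (n - 1) = k n"
    using n by (cases n) (auto simp: c_def)
  then have "2 * x n - x (n - 1) = k n" using xn n by (auto simp: x_def)
  moreover have "2 * x (n - 1) - x (n - 2) - 2 * x n = k (n - 1)"
    using chain_row[of "n - 1" c k] n unfolding xn by (auto simp: x_def numeral_2_eq_2)
  moreover have "2 * x i - x (i - 1) - x (i + 1) = k i" if "1 \<le> i" "i < n - 1" for i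
    using chain_row[of i c k] n that by (auto simp: x_def)
  moreover have "x 0 = 0" using n by (simp add: x_def)
  ultimately show ?thesis using that by blast
qed

lemma root_coordinates_C:
  assumes n: "2 \<le> n" and even: "even (\<Sum>j=1..n. if odd j then k j else 0)"
  shows "\<exists>x. \<forall>i\<in>{1..n}. k i = (\<Sum>j=1..n. cartan (Aff_C n) i j * x j)"
proof -
  obtain x where x0: "x 0 = 0" and x: "2 * x n - x (n - 1) = k n"
    "2 * x (n - 1) - x (n - 2) - 2 * x n = k (n - 1)"
    "\<And>i. 1 \<le> i \<Longrightarrow> i < n - 1 \<Longrightarrow> 2 * x i - x (i - 1) - x (i + 1) = k i"
    using halved_chain[OF n even] by blast
  have "k i = affine_row (Aff_C n) x i" if i: "i \<in> {1..n}" for i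
  proof -
    consider "i = n" | "i = n - 1" "i < n" | "1 = i" "i < n - 1" | "1 < i" "i < n - 1" using i n by fastforce
    then show ?thesis
      using n i x0 x(1,2) x(3)[of i] affine_row_C[of n i x]
      by cases (auto simp: numeral_2_eq_2)
  qed
  then show ?thesis using x0 by (intro root_coordinatesI[of x]) auto
qed

lemma root_coordinates_Tw_A_odd:
  assumes n: "3 \<le> n" and even: "even (\<Sum>j=1..n. if odd j then k j else 0)"
  shows "\<exists>x. \<forall>i\<in>{1..n}. k i = (\<Sum>j=1..n. cartan (Tw_A_odd n) i j * x j)"
proof -
  have "2 \<le> n" using n by simp
  then obtain x where x0: "x 0 = 0" and x: "2 * x n - x (n - 1) = k n"
    "2 * x (n - 1) - x (n - 2) - 2 * x n = k (n - 1)"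
    "\<And>i. 1 \<le> i \<Longrightarrow> i < n - 1 \<Longrightarrow> 2 * x i - x (i - 1) - x (i + 1) = k i"
    using halved_chain[OF _ even] by blast
  have "k i = affine_row (Tw_A_odd n) x i" if i: "i \<in> {1..n}" for i
  proof -
    consider "i = 1" | "i = n" "1 < i" | "i = n - 1" "i = 2" | "i = n - 1" "2 < i" | "i = 2" "i < n - 1"
      | "2 < i" "i < n - 1" using i n by fastforce
    then show ?thesis
      using n i x0 x(1,2) x(3)[of i] affine_row_Tw_A_odd[of n i x]
      by cases (auto simp: numeral_2_eq_2 numeral_3_eq_3)
  qed
  then show ?thesis using x0 by (intro root_coordinatesI[of x]) auto
qed

text \<open>The two fork entries meet the rest of the diagram only through their sum, so a plain
  chain can run on to \<open>m + 3\<close> with that sum as its value. The first parity makes the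
  sum integral, the second makes each fork entry integral.\<close>

lemma root_coordinates_D:
  fixes k :: "nat \<Rightarrow> int" and m :: nat
  defines "u \<equiv> k (m + 3) + k (m + 4)"
  assumes even: "even u"
    "even (int m * (u div 2) + (\<Sum>j=1..m + 2. if odd j then k j else 0) + k (m + 4))"
  shows "\<exists>x. \<forall>i\<in>{1..m + 4}. k i = (\<Sum>j=1..m + 4. cartan (Aff_D (m + 4)) i j * x j)"
proof -
  \<comment> \<open>Adding the two fork equations gives twice the sum of the fork entries minus
    twice the entry at \<open>m + 2\<close> as \<open>u\<close>; the increment into
    \<open>m + 3\<close> must therefore be \<open>u div 2\<close>.\<close>
  define c where "c = (\<Sum>j=1..m + 2. k j) + u div 2"
  define y where "y = chain c k"
  have y0: "y 0 = 0" by (simp add: y_def)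
  have yrow: "2 * y i - y (i - 1) - y (i + 1) = k i" if "1 \<le> i" for i
    using chain_row[OF that] by (simp add: y_def)
  have "even (y (m + 2) + k (m + 4))"
    using even even_sum_odd_entries_iff[of k "m + 2"] by (simp add: y_def chain_closed_form c_def)
  moreover from this have "even (y (m + 2) + k (m + 3))" using even(1) by (simp add: u_def)
  ultimately obtain d e where de: "y (m + 2) + k (m + 3) = 2 * d" "y (m + 2) + k (m + 4) = 2 * e"
    unfolding dvd_def by blast
  define x where "x = y(m + 3 := d, m + 4 := e)"
  have x: "x (m + 3) = d" "x (m + 4) = e" "\<And>i. i \<le> m + 2 \<Longrightarrow> x i = y i"
    by (simp_all add: x_def)
  have "y (m + 3) = y (m + 2) + u div 2"
    by (simp add: y_def c_def numeral_3_eq_3 numeral_2_eq_2)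
  moreover have "2 * (u div 2) = u" using even(1) by simp
  ultimately have xsum: "d + e = y (m + 3)"
    using de by (simp add: u_def)
  have "k i = affine_row (Aff_D (m + 4)) x i" if i: "i \<in> {1..m + 4}" for i
  proof -
    have row: "affine_row (Aff_D (m + 4)) x i = 2 * x i -
      (if i \<le> 1 then x 2 else if m + 3 \<le> i then x (m + 2)
       else (if i = m + 2 then x (m + 4) else 0) + x (i - 1) + x (i + 1))"
      using affine_row_D[of i m x] i y0 x(3)[of 0] by simp
    consider "i = 1" | "1 < i" "i < m + 2" | "i = m + 2" | "i = m + 3" | "i = m + 4"
      using i by fastforce
    then show ?thesis
    proof cases
      case 1
      then show ?thesis using yrow[of 1] unfolding row by (simp add: x y0 numeral_2_eq_2)
    next
      case 2
      then show ?thesis using yrow[of i] unfolding row by (simp add: x)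
    next
      case 3
      have "2 * y (m + 2) - y (m + 1) - y (m + 3) = k (m + 2)"
        using yrow[of "m + 2"] by (simp add: numeral_3_eq_3)
      moreover have "x (m + 2 + 1) = d" using x(1) by (simp add: numeral_3_eq_3)
      ultimately show ?thesis using 3 xsum unfolding row by (simp add: x)
    next
      case 4
      then show ?thesis using de unfolding row by (simp add: x)
    next
      case 5
      then show ?thesis using de unfolding row by (simp add: x)
    qed
  qed
  moreover have "x 0 = 0" using x(3)[of 0] y0 by simp
  ultimately show ?thesis by (intro root_coordinatesI[of x]) auto
qed

section \<open>Integral preimages in the exceptional types\<close>

text \<open>
  In the exceptional types the coordinates are read off the inverse of the finite Cartan matrix; the
  congruence is used to eliminate \<open>k\<^sub>1\<close> (for $E_6$) or \<open>k\<^sub>7\<close> (for $E_7$), which clears the denominators.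
\<close>

lemma root_coordinates_E6:
  assumes "3 dvd k 1 + 2 * k 3 + k 5 + 2 * k 6"
  shows "\<exists>x. \<forall>i\<in>{1..6}. k i = (\<Sum>j=1..6. cartan Aff_E6 i j * x j)"
proof -
  obtain c where c: "k 1 + 2 * k 3 + k 5 + 2 * k 6 = 3 * c" using assms by blast
  define x where "x = (\<lambda>j. [4 * c + k 2 - k 3 + 2 * k 4 - 2 * k 6,
    3 * c + 2 * k 2 + 3 * k 4 + k 5 - k 6,
    5 * c + 2 * k 2 + 4 * k 4 + k 5 - 2 * k 6,
    6 * c + 3 * k 2 + 6 * k 4 + 2 * k 5 - 2 * k 6,
    4 * c + 2 * k 2 + 4 * k 4 + 2 * k 5 - k 6,
    2 * c + k 2 + 2 * k 4 + k 5] ! (j - 1))"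
  have I: "{1..6} = {1, 2, 3, 4, 5, 6 :: nat}" by auto
  have "\<forall>i\<in>{1..6}. k i = (\<Sum>j=1..6. cartan Aff_E6 i j * x j)"
    unfolding I x_def using c by (simp add: cartan_def)
  then show ?thesis by blast
qed

lemma root_coordinates_E7:
  assumes "even (k 2 + k 5 + k 7)"
  shows "\<exists>x. \<forall>i\<in>{1..7}. k i = (\<Sum>j=1..7. cartan Aff_E7 i j * x j)"
proof -
  obtain c where c: "k 2 + k 5 + k 7 = 2 * c" using assms by blast
  define x where "x = (\<lambda>j. [2 * c + 2 * k 1 + k 2 + 3 * k 3 + 4 * k 4 + 2 * k 5 + 2 * k 6,
    3 * c + 2 * k 1 + 2 * k 2 + 4 * k 3 + 6 * k 4 + 3 * k 5 + 3 * k 6,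
    4 * c + 3 * k 1 + 2 * k 2 + 6 * k 3 + 8 * k 4 + 4 * k 5 + 4 * k 6,
    6 * c + 4 * k 1 + 3 * k 2 + 8 * k 3 + 12 * k 4 + 6 * k 5 + 6 * k 6,
    5 * c + 3 * k 1 + 2 * k 2 + 6 * k 3 + 9 * k 4 + 5 * k 5 + 5 * k 6,
    4 * c + 2 * k 1 + k 2 + 4 * k 3 + 6 * k 4 + 3 * k 5 + 4 * k 6,
    3 * c + k 1 + 2 * k 3 + 3 * k 4 + k 5 + 2 * k 6] ! (j - 1))"
  have I: "{1..7} = {1, 2, 3, 4, 5, 6, 7 :: nat}" by auto
  have "\<forall>i\<in>{1..7}. k i = (\<Sum>j=1..7. cartan Aff_E7 i j * x j)"
    unfolding I x_def using c by (simp add: cartan_def)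
  then show ?thesis by blast
qed

lemma root_coordinates_E8:
  shows "\<exists>x. \<forall>i\<in>{1..8}. k i = (\<Sum>j=1..8. cartan Aff_E8 i j * x j)"
proof -
  \<comment> \<open>The Cartan matrix of E_8 is unimodular, so its inverse is integral and no
    congruence enters. The same holds for F_4 and G_2 below, in both labellings.\<close>
  define x where "x = (\<lambda>j. [2 * k 1 + 3 * k 2 + 4 * k 3 + 5 * k 4 + 6 * k 5 + 4 * k 6 + 2 * k 7 + 3 * k 8,
    3 * k 1 + 6 * k 2 + 8 * k 3 + 10 * k 4 + 12 * k 5 + 8 * k 6 + 4 * k 7 + 6 * k 8,
    4 * k 1 + 8 * k 2 + 12 * k 3 + 15 * k 4 + 18 * k 5 + 12 * k 6 + 6 * k 7 + 9 * k 8,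
    5 * k 1 + 10 * k 2 + 15 * k 3 + 20 * k 4 + 24 * k 5 + 16 * k 6 + 8 * k 7 + 12 * k 8,
    6 * k 1 + 12 * k 2 + 18 * k 3 + 24 * k 4 + 30 * k 5 + 20 * k 6 + 10 * k 7 + 15 * k 8,
    4 * k 1 + 8 * k 2 + 12 * k 3 + 16 * k 4 + 20 * k 5 + 14 * k 6 + 7 * k 7 + 10 * k 8,
    2 * k 1 + 4 * k 2 + 6 * k 3 + 8 * k 4 + 10 * k 5 + 7 * k 6 + 4 * k 7 + 5 * k 8,
    3 * k 1 + 6 * k 2 + 9 * k 3 + 12 * k 4 + 15 * k 5 + 10 * k 6 + 5 * k 7 + 8 * k 8] ! (j - 1))"
  have I: "{1..8} = {1, 2, 3, 4, 5, 6, 7, 8 :: nat}" by auto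
  have "\<forall>i\<in>{1..8}. k i = (\<Sum>j=1..8. cartan Aff_E8 i j * x j)"
    unfolding I x_def by (simp add: cartan_def)
  then show ?thesis by blast
qed

lemma root_coordinates_F4:
  shows "\<exists>x. \<forall>i\<in>{1..4}. k i = (\<Sum>j=1..4. cartan Aff_F4 i j * x j)"
proof -
  define x where "x = (\<lambda>j. [2 * k 1 + 3 * k 2 + 2 * k 3 + k 4,
    3 * k 1 + 6 * k 2 + 4 * k 3 + 2 * k 4,
    4 * k 1 + 8 * k 2 + 6 * k 3 + 3 * k 4,
    2 * k 1 + 4 * k 2 + 3 * k 3 + 2 * k 4] ! (j - 1))"
  have I: "{1..4} = {1, 2, 3, 4 :: nat}" by auto
  have "\<forall>i\<in>{1..4}. k i = (\<Sum>j=1..4. cartan Aff_F4 i j * x j)"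
    unfolding I x_def by (simp add: cartan_def)
  then show ?thesis by blast
qed

lemma root_coordinates_G2:
  shows "\<exists>x. \<forall>i\<in>{1..2}. k i = (\<Sum>j=1..2. cartan Aff_G2 i j * x j)"
proof -
  define x where "x = (\<lambda>j. [2 * k 1 + k 2,
    3 * k 1 + 2 * k 2] ! (j - 1))"
  have I: "{1..2} = {1, 2 :: nat}" by auto
  have "\<forall>i\<in>{1..2}. k i = (\<Sum>j=1..2. cartan Aff_G2 i j * x j)"
    unfolding I x_def by (simp add: cartan_def)
  then show ?thesis by blast
qed

lemma root_coordinates_Tw_E6:
  shows "\<exists>x. \<forall>i\<in>{1..4}. k i = (\<Sum>j=1..4. cartan Tw_E6 i j * x j)"
proof -
  define x where "x = (\<lambda>j. [2 * k 1 + 3 * k 2 + 4 * k 3 + 2 * k 4,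
    3 * k 1 + 6 * k 2 + 8 * k 3 + 4 * k 4,
    2 * k 1 + 4 * k 2 + 6 * k 3 + 3 * k 4,
    k 1 + 2 * k 2 + 3 * k 3 + 2 * k 4] ! (j - 1))"
  have I: "{1..4} = {1, 2, 3, 4 :: nat}" by auto
  have "\<forall>i\<in>{1..4}. k i = (\<Sum>j=1..4. cartan Tw_E6 i j * x j)"
    unfolding I x_def by (simp add: cartan_def)
  then show ?thesis by blast
qed

lemma root_coordinates_Tw_D4:
  shows "\<exists>x. \<forall>i\<in>{1..2}. k i = (\<Sum>j=1..2. cartan Tw_D4 i j * x j)"
proof -
  define x where "x = (\<lambda>j. [2 * k 1 + 3 * k 2,
    k 1 + 2 * k 2] ! (j - 1))"
  have I: "{1..2} = {1, 2 :: nat}" by auto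
  have "\<forall>i\<in>{1..2}. k i = (\<Sum>j=1..2. cartan Tw_D4 i j * x j)"
    unfolding I x_def by (simp add: cartan_def)
  then show ?thesis by blast
qed

section \<open>From the sieving congruences to root coordinates\<close>

lemma root_coordinates_if_sieved:
  assumes X: "valid_type X" "\<forall>n. X \<noteq> Tw_A_even n"
    and k: "\<forall>s\<in>set (sieving_set X). int (weight_index X) dvd (\<Sum>i=1..rank X. s i * k i)"
  shows "\<exists>x. \<forall>i\<in>{1..rank X}. k i = (\<Sum>j=1..rank X. cartan X i j * x j)"
proof -
  have pick: "(\<Sum>i=1..n. (if i = n then 1 else 0) * k i) = k n" if "1 \<le> n" for n :: nat
  proof -
    have "(\<Sum>i=1..n. (if i = n then 1 else 0) * k i) = (\<Sum>i=1..n. if i = n then k i else 0)"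
      by (rule sum.cong) auto
    then show ?thesis using that by simp
  qed
  have odds: "(\<Sum>i=1..n. (if odd i then 1 else 0) * k i) = (\<Sum>i=1..n. if odd i then k i else 0)" for n :: nat
    by (rule sum.cong) auto
  show ?thesis
  proof (cases X)
    case (Aff_A n)
    then show ?thesis using X k root_coordinates_A[of n k] by simp
  next
    case (Aff_B n)
    then show ?thesis using X k pick[of n] root_coordinates_B[of n k] by simp
  next
    case (Tw_D n)
    then show ?thesis using X k pick[of n] root_coordinates_Tw_D[of n k] by simp
  next
    case (Aff_C n)
    then show ?thesis using X k root_coordinates_C[of n k] by (simp add: odds[unfolded One_nat_def])
  next
    case (Tw_A_odd n)
    then show ?thesis using X k root_coordinates_Tw_A_odd[of n k] by (simp add: odds[unfolded One_nat_def])
  next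
    case (Aff_D n)
    then obtain m where m: "n = m + 4"
      using X by (metis valid_type.simps(4) le_add_diff_inverse2)
    define q where "q = (\<Sum>i=1..m + 2. if odd i then k i else 0)"
    have split: "(\<Sum>i=1..m + 4. s i * k i)
        = (\<Sum>i=1..m + 2. s i * k i) + s (m + 3) * k (m + 3) + s (m + 4) * k (m + 4)" for s
      by (simp add: numeral_eq_Suc)
    have head: "(\<Sum>i=1..m + 2. (if odd i then 2 else 0) * k i) = 2 * q"
      unfolding q_def sum_distrib_left by (rule sum.cong) auto
    show ?thesis
    proof (cases "odd m")
      case True
      let ?s = "\<lambda>j. if j = m + 4 then 3 else if j = m + 3 then 1 else if odd j then 2 else 0 :: int"
      have S: "sieving_set X = [?s]" "rank X = m + 4" "weight_index X = 4"
        using True by (auto simp: Aff_D m fun_eq_iff)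
      have "(\<Sum>i=1..m + 2. ?s i * k i) = (\<Sum>i=1..m + 2. (if odd i then 2 else 0) * k i)"
        by (rule sum.cong) (auto simp: m)
      then have "4 dvd 2 * q + k (m + 3) + 3 * k (m + 4)"
        using k split[of ?s] head unfolding S by simp
      then obtain d where d: "2 * q + k (m + 3) + 3 * k (m + 4) = 4 * d" by blast
      \<comment> \<open>One congruence modulo 4 carries both parities. Solving it for the fork sum
        yields \<open>2 * u\<close>; replacing \<open>q + k (m + 4)\<close> by
        \<open>2 * d - u\<close> leaves \<open>(int m - 1) * u + 2 * d\<close>, which is even for
        odd \<open>m\<close>.\<close>
      define u where "u = 2 * d - q - k (m + 4)"
      have u: "k (m + 3) + k (m + 4) = 2 * u" using d by (simp add: u_def)
      have "int m * u + q + k (m + 4) = (int m - 1) * u + 2 * d" by (simp add: u_def algebra_simps)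
      then have "even (int m * u + q + k (m + 4))" using True by simp
      then show ?thesis using root_coordinates_D[of k m, folded q_def] u by (simp add: Aff_D m)
    next
      case False
      let ?s = "\<lambda>j. if j = n - 1 \<or> j = n then 2 else 0 :: int"
      have "(\<Sum>i=1..m + 2. ?s i * k i) = 0"
        by (rule sum.neutral) (auto simp: m)
      then have "4 dvd 2 * k (m + 3) + 2 * k (m + 4)"
        using k False split[of ?s] by (simp add: Aff_D m)
      then have "even (k (m + 3) + k (m + 4))" by presburger
      then obtain u where u: "k (m + 3) + k (m + 4) = 2 * u" by blast
      \<comment> \<open>The second vector is supported on the odd nodes, which include
        \<open>m + 3\<close> but not \<open>m + 4\<close>. The even fork sum then allows
        \<open>k (m + 3)\<close> to be traded for \<open>k (m + 4)\<close>.\<close>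
      have "4 dvd 2 * q + 2 * k (m + 3)"
        using k False split[of "\<lambda>j. if odd j then 2 else 0"] head by (simp add: Aff_D m)
      then have "even (q + k (m + 3))" by presburger
      then have "even (q + k (m + 4))" using u by presburger
      then have "even (int m * u + q + k (m + 4))" using False by (simp add: add.assoc)
      then show ?thesis using root_coordinates_D[of k m, folded q_def] u by (simp add: Aff_D m)
    qed
  next
    case Aff_E6
    have I: "{1..6} = {1, 2, 3, 4, 5, 6 :: nat}" by auto
    have "3 dvd k 1 + 2 * k 3 + k 5 + 2 * k 6" using k Aff_E6 I by (simp add: add.assoc)
    then show ?thesis using root_coordinates_E6 Aff_E6 by simp
  next
    case Aff_E7
    have I: "{1..7} = {1, 2, 3, 4, 5, 6, 7 :: nat}" by auto
    have "even (k 2 + k 5 + k 7)" using k Aff_E7 I by (simp add: add.assoc)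
    then show ?thesis using root_coordinates_E7 Aff_E7 by simp
  next
    case Aff_E8
    then show ?thesis using root_coordinates_E8 by simp
  next
    case Aff_F4
    then show ?thesis using root_coordinates_F4 by simp
  next
    case Aff_G2
    then show ?thesis using root_coordinates_G2 by simp
  next
    case Tw_E6
    then show ?thesis using root_coordinates_Tw_E6 by simp
  next
    case Tw_D4
    then show ?thesis using root_coordinates_Tw_D4 by simp
  qed (use X in auto)
qed

text \<open>The columns generate the image, so the congruences for them give one direction after
  exchanging the sums; the other is the case analysis above.\<close>

lemma root_coordinates_iff:
  assumes X: "valid_type X" "\<forall>n. X \<noteq> Tw_A_even n"
  shows "(\<exists>x. \<forall>i\<in>{1..rank X}. k i = (\<Sum>j=1..rank X. cartan X i j * x j)) \<longleftrightarrow>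
    (\<forall>s\<in>set (sieving_set X). int (weight_index X) dvd (\<Sum>i=1..rank X. s i * k i))"
proof
  assume "\<exists>x. \<forall>i\<in>{1..rank X}. k i = (\<Sum>j=1..rank X. cartan X i j * x j)"
  then obtain x where x: "\<And>i. i \<in> {1..rank X} \<Longrightarrow> k i = (\<Sum>j=1..rank X. cartan X i j * x j)"
    by blast
  show "\<forall>s\<in>set (sieving_set X). int (weight_index X) dvd (\<Sum>i=1..rank X. s i * k i)"
  proof
    fix s assume s: "s \<in> set (sieving_set X)"
    have "(\<Sum>i=1..rank X. s i * k i) = (\<Sum>i=1..rank X. \<Sum>j=1..rank X. s i * cartan X i j * x j)"
      using x by (intro sum.cong) (auto simp: sum_distrib_left mult.assoc)
    also have "\<dots> = (\<Sum>j=1..rank X. (\<Sum>i=1..rank X. s i * cartan X i j) * x j)"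
      by (subst sum.swap) (simp add: sum_distrib_right)
    finally show "int (weight_index X) dvd (\<Sum>i=1..rank X. s i * k i)"
      using column_sum_divisible[OF X s] by (auto intro!: dvd_sum)
  qed
qed (rule root_coordinates_if_sieved[OF X])

section \<open>Number of residue vectors\<close>

lemma card_residues_single:
  fixes s :: "nat \<Rightarrow> int"
  assumes N: "N = 1 \<or> (\<exists>g\<in>{1..n}. s g = 1)" "0 < N"
  shows "card (range (\<lambda>k. map (\<lambda>s. (\<Sum>i=1..n. s i * k i) mod int N) [s])) = N"
proof -
  have "range (\<lambda>k. map (\<lambda>s. (\<Sum>i=1..n. s i * k i) mod int N) [s]) = (\<lambda>a. [a]) ` {0..<int N}"
  proof (intro set_eqI iffI)
    fix v assume "v \<in> (\<lambda>a. [a]) ` {0..<int N}"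
    then obtain a where a: "v = [a]" "0 \<le> a" "a < int N" by auto
    show "v \<in> range (\<lambda>k. map (\<lambda>s. (\<Sum>i=1..n. s i * k i) mod int N) [s])"
    proof (cases "N = 1")
      case True
      then show ?thesis using a by auto
    next
      case False
      \<comment> \<open>A node with coefficient 1 attains every residue: place the residue there and
        0 elsewhere.\<close>
      then obtain g where g: "g \<in> {1..n}" "s g = 1" using N by auto
      have "(\<Sum>i=1..n. s i * (if i = g then a else 0)) = (\<Sum>i=1..n. if i = g then a else 0)"
        using g by (intro sum.cong) auto
      then have "v = map (\<lambda>s. (\<Sum>i=1..n. s i * (if i = g then a else 0)) mod int N) [s]"
        using a g by simp
      then show ?thesis
        by (intro range_eqI[where x = "\<lambda>i. if i = g then a else 0"]) simp
    qed
  qed (use N in auto)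
  then show ?thesis by (simp add: card_image inj_on_def)
qed

text \<open>Both functionals are doubled, so each takes only the values 0 and 2 modulo 4. They vary
  independently: node \<open>n\<close> is even and is seen only by the first, node 1 only by the
  second.\<close>

lemma card_residues_D_even:
  assumes X: "X = Aff_D n" "4 \<le> n" "even n"
  shows "card (range (\<lambda>k. map (\<lambda>s. (\<Sum>i=1..n. s i * k i) mod 4) (sieving_set X))) = 4"
    (is "card (range ?f) = 4")
proof -
  define s t :: "nat \<Rightarrow> int" where "s = (\<lambda>j. if j = n - 1 \<or> j = n then 2 else 0 :: int)"
    and "t = (\<lambda>j. if odd j then 2 else 0 :: int)"
  have f: "?f = (\<lambda>k. [(\<Sum>i=1..n. s i * k i) mod 4, (\<Sum>i=1..n. t i * k i) mod 4])"
    using X by (simp add: s_def t_def)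
  have even: "\<exists>a. (\<Sum>i=1..n. (if P i then 2 else 0) * k i) = 2 * a" for P :: "nat \<Rightarrow> bool" and k :: "nat \<Rightarrow> int"
  proof
    show "(\<Sum>i=1..n. (if P i then 2 else 0) * k i) = 2 * (\<Sum>i=1..n. if P i then k i else 0)"
      unfolding sum_distrib_left by (rule sum.cong) auto
  qed
  have mod4: "2 * a mod 4 \<in> {0, 2}" for a :: int by (simp add: mult_mod_right[of 2 a 2, symmetric]) presburger
  have "range ?f = {[0, 0], [0, 2], [2, 0], [2, 2]}"
  proof
    show "range ?f \<subseteq> {[0, 0], [0, 2], [2, 0], [2, 2]}"
    proof
      fix v assume "v \<in> range ?f"
      then obtain k where v: "v = [(\<Sum>i=1..n. s i * k i) mod 4, (\<Sum>i=1..n. t i * k i) mod 4]"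
        unfolding f by auto
      obtain a b where "(\<Sum>i=1..n. s i * k i) = 2 * a" "(\<Sum>i=1..n. t i * k i) = 2 * b"
        unfolding s_def t_def using even by meson
      then show "v \<in> {[0, 0], [0, 2], [2, 0], [2, 2]}" using v mod4[of a] mod4[of b] by auto
    qed
    have attained: "[s n * a mod 4, t 1 * b mod 4] \<in> range ?f" if "a \<in> {0, 1}" "b \<in> {0, 1}" for a b :: int
    proof -
      let ?k = "\<lambda>j. (if j = n then a else 0) + (if j = 1 then b else 0)"
      have "(\<Sum>i=1..n. s i * ?k i) = (\<Sum>i=1..n. if i = n then s n * a else 0)"
        using X by (intro sum.cong) (auto simp: s_def)
      moreover have "(\<Sum>i=1..n. t i * ?k i) = (\<Sum>i=1..n. if i = 1 then t 1 * b else 0)"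
        using X by (intro sum.cong) (auto simp: t_def)
      ultimately show ?thesis
        unfolding f using X by (intro range_eqI[where x = ?k]) simp
    qed
    show "{[0, 0], [0, 2], [2, 0], [2, 2]} \<subseteq> range ?f"
      using attained[of 0 0] attained[of 0 1] attained[of 1 0] attained[of 1 1] by (simp add: s_def t_def)
  qed
  then show ?thesis by simp
qed

lemma card_residues:
  assumes X: "valid_type X" "\<forall>n. X \<noteq> Tw_A_even n"
  shows "card (range (\<lambda>k. map (\<lambda>s. (\<Sum>i=1..rank X. s i * k i) mod int (weight_index X)) (sieving_set X)))
    = weight_index X"
proof (cases "\<exists>n. X = Aff_D n \<and> even n")
  case True
  then show ?thesis using X card_residues_D_even[of X] by auto
next
  case False
  \<comment> \<open>A single vector remains, and where the index exceeds 1 it has an entry 1, for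
    instance at \<open>n - 1\<close> in D_n with odd \<open>n\<close> and at 2 in E_7.\<close>
  have "\<exists>s. sieving_set X = [s] \<and> (weight_index X = 1 \<or> (\<exists>g\<in>{1..rank X}. s g = 1))"
  proof (cases X)
    case (Aff_D n)
    then have "n - 1 \<in> {1..n}" "n - 1 \<noteq> n" using X by auto
    then show ?thesis using Aff_D False by (auto intro!: bexI[of _ "n - 1"])
  next
    case Aff_E7
    then show ?thesis by (auto intro!: bexI[of _ 2])
  qed (use X in \<open>auto intro: bexI[of _ 1]\<close>)
  then obtain s where s: "sieving_set X = [s]" "weight_index X = 1 \<or> (\<exists>g\<in>{1..rank X}. s g = 1)"
    by blast
  have "0 < weight_index X" by (cases X) auto
  then show ?thesis using card_residues_single[OF s(2)] s(1) by simp
qed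

section \<open>Linear algebra of a realization\<close>

text \<open>The dimension of an infinite-dimensional space is 0 by convention; positivity is thus
  what makes the extended basis finite.\<close>

lemma extend_to_spanning:
  fixes S :: "'a::real_vector set"
  assumes "independent S" "dim (UNIV :: 'a set) > 0"
  obtains T where "S \<subseteq> T" "finite T" "card T = dim (UNIV :: 'a set)" "span T = UNIV"
proof -
  obtain T where T: "S \<subseteq> T" "independent T" "UNIV \<subseteq> span T"
    using real_vector.maximal_independent_subset_extend[OF subset_UNIV assms(1)] by auto
  then have "span T = UNIV" by auto
  then have "card T = dim (UNIV :: 'a set)"
    using real_vector.dim_eq_card[of T UNIV] T(2) by simp
  moreover from this have "finite T" using assms(2) by (metis card.infinite less_irrefl)
  ultimately show ?thesis using that T by auto
qed

lemma span_eq_UNIV_if_card_eq_dim: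
  fixes S :: "'a::real_vector set"
  assumes "independent S" "finite S" "card S = dim (UNIV :: 'a set)" "dim (UNIV :: 'a set) > 0"
  shows "span S = UNIV"
  using extend_to_spanning[OF assms(1,4)] assms(3) by (metis card_subset_eq)

lemma extend_to_spanning_insert:
  fixes S :: "'a::real_vector set"
  assumes "independent S" "finite S" "Suc (card S) = dim (UNIV :: 'a set)"
  obtains d where "span (insert d S) = UNIV"
proof -
  obtain T where T: "S \<subseteq> T" "finite T" "card T = dim (UNIV :: 'a set)" "span T = UNIV"
    using extend_to_spanning[OF assms(1)] assms(3) by (metis zero_less_Suc)
  then have "card (T - S) = 1" using assms by (simp add: card_Diff_subset)
  then obtain d where "T - S = {d}" by (auto simp: card_1_singleton_iff)
  then have "T = insert d S" using T(1) by auto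
  then show ?thesis using that T(4) by auto
qed

text \<open>Modulo the span of \<open>S\<close> there is one further direction \<open>d\<close>, so
  by nondegeneracy a vector annihilated by \<open>S\<close> is determined by its pairing with
  \<open>d\<close>. This supplies the corank one property of affine matrices.\<close>

lemma annihilator_of_hyperplane_is_line:
  fixes p :: "'a::real_vector \<Rightarrow> 'b::real_vector \<Rightarrow> real"
  assumes p: "bilinear p" and nondeg: "\<And>y. (\<And>x. p x y = 0) \<Longrightarrow> y = 0"
    and S: "independent S" "finite S" "Suc (card S) = dim (UNIV :: 'a set)"
    and u: "u \<noteq> 0" "\<And>x. x \<in> S \<Longrightarrow> p x u = 0"
    and v: "\<And>x. x \<in> S \<Longrightarrow> p x v = 0"
  obtains t where "v = t *\<^sub>R u"
proof -
  obtain d where d: "span (insert d S) = UNIV" by (rule extend_to_spanning_insert[OF S])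
  have zero: "w = 0" if "\<And>x. x \<in> insert d S \<Longrightarrow> p x w = 0" for w
  proof (rule nondeg)
    fix x
    have "linear (\<lambda>x. p x w)" using p by (simp add: bilinear_def)
    moreover have "x \<in> span (insert d S)" using d by simp
    ultimately show "p x w = 0" using that linear_eq_0_on_span by blast
  qed
  have "p d u \<noteq> 0" using zero[of u] u by auto
  then have "v - (p d v / p d u) *\<^sub>R u = 0"
    using u v by (intro zero) (auto simp: bilinear_rsub[OF p] bilinear_rmul[OF p])
  then show ?thesis using that by simp
qed

text \<open>The entry \<open>v 0 = 1\<close> gives \<open>t = 1 / a 0\<close>, so every
  \<open>a i\<close> is the integer multiple \<open>v i * a 0\<close>, and \<open>a 0\<close>
  divides the gcd.\<close>

lemma coprime_kernel_vector_normalized: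
  fixes a :: "nat \<Rightarrow> nat" and v :: "nat \<Rightarrow> int"
  assumes a: "Gcd (a ` {..n}) = 1" and v: "v 0 = 1"
    and t: "\<And>i. i \<le> n \<Longrightarrow> real_of_int (v i) = t * real (a i)"
  shows "a 0 = 1"
proof -
  have "1 = t * real (a 0)" using t[of 0] v by simp
  then have "real (a i) = real_of_int (v i) * real (a 0)" if "i \<le> n" for i
    using t[OF that] by (metis mult.assoc mult.commute mult.right_neutral)
  then have "int (a i) = v i * int (a 0)" if "i \<le> n" for i
    using that by (metis of_int_eq_iff of_int_mult of_int_of_nat_eq)
  then have "a 0 dvd a i" if "i \<le> n" for i
    using that by (metis dvd_triv_right int_dvd_int_iff)
  then have "a 0 dvd Gcd (a ` {..n})" by (auto intro: Gcd_greatest)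
  then show ?thesis using a by simp
qed


lemma independent_family_coefficients_unique:
  fixes r :: "nat \<Rightarrow> 'a::real_vector"
  assumes r: "inj_on r A" "independent (r ` A)" "finite A"
    and eq: "(\<Sum>i\<in>A. f i *\<^sub>R r i) = (\<Sum>i\<in>A. g i *\<^sub>R r i)" and i: "i \<in> A"
  shows "f i = g i"
proof -
  define u where "u v = f (inv_into A r v) - g (inv_into A r v)" for v
  have "(\<Sum>v\<in>r ` A. u v *\<^sub>R v) = (\<Sum>i\<in>A. (f i - g i) *\<^sub>R r i)"
    using r by (subst sum.reindex) (auto simp: u_def intro!: sum.cong)
  also have "\<dots> = 0" using eq by (simp add: scaleR_diff_left sum_subtractf)
  finally have "u (r i) = 0"
    using independentD[OF r(2)] r(3) i by blast
  then show ?thesis using r i by (simp add: u_def)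
qed

lemma span_finite_family:
  fixes r :: "nat \<Rightarrow> 'a::real_vector"
  assumes "inj_on r A" "finite A" "v \<in> span (r ` A)"
  obtains c where "v = (\<Sum>i\<in>A. c i *\<^sub>R r i)"
proof -
  obtain u where "v = (\<Sum>w\<in>r ` A. u w *\<^sub>R w)"
    using assms by (auto simp: span_finite)
  then have "v = (\<Sum>i\<in>A. (u \<circ> r) i *\<^sub>R r i)"
    using assms by (subst (asm) sum.reindex) auto
  then show ?thesis by (rule that)
qed

lemma linear_combination:
  fixes f :: "'a::real_vector \<Rightarrow> 'b::real_vector"
  assumes "linear f"
  shows "f (\<Sum>i\<in>A. c i *\<^sub>R r i) = (\<Sum>i\<in>A. c i *\<^sub>R f (r i))"
  using assms by (simp add: linear_sum linear_scale)

text \<open>A kernel vector of \<open>A\<close> gives a combination of the \<open>r j\<close>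
  annihilated by all \<open>h i\<close>, which span a hyperplane. Hence \<open>a\<close> and
  \<open>v\<close> are proportional and coprimality applies. The pairing is abstract so that roots
  and coroots may be exchanged.\<close>

lemma kernel_label_normalized:
  fixes p :: "'a::real_vector \<Rightarrow> 'b::real_vector \<Rightarrow> real" and h :: "nat \<Rightarrow> 'a" and r :: "nat \<Rightarrow> 'b"
  assumes p: "bilinear p" and nondeg: "\<And>y. (\<And>x. p x y = 0) \<Longrightarrow> y = 0"
    and h: "inj_on h {..n}" "independent (h ` {..n})" "dim (UNIV :: 'a set) = n + 2"
    and r: "inj_on r {..n}" "independent (r ` {..n})"
    and A: "\<And>i j. i \<le> n \<Longrightarrow> j \<le> n \<Longrightarrow> p (h i) (r j) = of_int (A i j)"
    and a: "numerical_labels n A a"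
    and v: "v 0 = 1" "\<And>i. i \<le> n \<Longrightarrow> (\<Sum>j\<le>n. A i j * v j) = 0"
  shows "a 0 = 1"
proof -
  have kills: "p x (\<Sum>j\<le>n. of_int (w j) *\<^sub>R r j) = 0"
    if "\<And>i. i \<le> n \<Longrightarrow> (\<Sum>j\<le>n. A i j * w j) = 0" and x: "x \<in> h ` {..n}" for w x
  proof -
    obtain i where i: "x = h i" "i \<le> n" using x by auto
    have "linear (p (h i))" using p by (simp add: bilinear_def)
    then have "p x (\<Sum>j\<le>n. of_int (w j) *\<^sub>R r j) = of_int (\<Sum>j\<le>n. A i j * w j)"
      using A i by (simp add: linear_combination[OF \<open>linear (p (h i))\<close>] mult.commute)
    then show ?thesis using that(1)[OF i(2)] by (simp only: of_int_0)
  qed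
  let ?u = "\<Sum>j\<le>n. of_int (int (a j)) *\<^sub>R r j" and ?w = "\<Sum>j\<le>n. of_int (v j) *\<^sub>R r j"
  have u0: "?u \<noteq> 0"
  proof
    assume "?u = 0"
    then have "?u = (\<Sum>j\<le>n. 0 *\<^sub>R r j)" by simp
    then have "real_of_int (int (a 0)) = 0"
      by (rule independent_family_coefficients_unique[OF r finite_atMost]) auto
    then show False using a by (auto simp: numerical_labels_def)
  qed
  have card: "Suc (card (h ` {..n})) = dim (UNIV :: 'a set)" using h by (simp add: card_image)
  have kill: "p x ?u = 0" "p x ?w = 0" if "x \<in> h ` {..n}" for x
    using kills[of "\<lambda>j. int (a j)" x] kills[of v x] that a v(2) by (simp_all add: numerical_labels_def)
  obtain t where "?w = t *\<^sub>R ?u"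
    by (rule annihilator_of_hyperplane_is_line[OF p nondeg h(2) finite_imageI[OF finite_atMost] card u0 kill])
  then have "?w = (\<Sum>j\<le>n. (t * real (a j)) *\<^sub>R r j)" by (simp add: scaleR_sum_right)
  then have "real_of_int (v i) = t * real (a i)" if "i \<le> n" for i
    by (rule independent_family_coefficients_unique[OF r finite_atMost]) (use that in auto)
  then show ?thesis
    using a v(1) by (intro coprime_kernel_vector_normalized[of a n v t]) (auto simp: numerical_labels_def)
qed

lemma card_quotient_kernel:
  "card (A // {(x, y). x \<in> A \<and> y \<in> A \<and> f x = f y}) = card (f ` A)"
proof -
  let ?R = "{(x, y). x \<in> A \<and> y \<in> A \<and> f x = f y}"
  have "A // ?R = (\<lambda>x. ?R `` {x}) ` A"
    by (auto simp: quotient_def)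
  also have "\<dots> = (\<lambda>x. {y \<in> A. f y = f x}) ` A"
    by (rule image_cong) auto
  also have "\<dots> = (\<lambda>z. {y \<in> A. f y = z}) ` f ` A"
    by (simp add: image_image)
  finally have "A // ?R = (\<lambda>z. {y \<in> A. f y = z}) ` f ` A" .
  moreover have "inj_on (\<lambda>z. {y \<in> A. f y = z}) (f ` A)"
    by (rule inj_onI) blast
  ultimately show ?thesis by (simp add: card_image)
qed

section \<open>Weights, roots and the projection of an affine datum\<close>

locale affine_realization =
  fixes D :: "('h::real_vector, 'd::real_vector) affine_datum"
  assumes datum: "is_affine_datum D" and not_A_even: "\<forall>n. atype D \<noteq> Tw_A_even n"
begin

lemma valid: "valid_type (atype D)"
  using datum by (simp add: is_affine_datum_def)

lemma linear_pair: "linear (pair D x)" and linear_pair_left: "linear (\<lambda>x. pair D x \<mu>)"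
  and linear_form: "linear (form D \<mu>)" and linear_form_left: "linear (\<lambda>\<mu>. form D \<mu> \<nu>)"
  using datum by (simp_all add: is_affine_datum_def bilinear_def)

lemma pair_coroot_root:
  "i \<le> rk D \<Longrightarrow> j \<le> rk D \<Longrightarrow> pair D (coroot D i) (root D j) = of_int (cartan (atype D) i j)"
  and pair_coroot_fweight:
  "i \<le> rk D \<Longrightarrow> j \<le> rk D \<Longrightarrow> pair D (coroot D j) (fweight D i) = (if i = j then 1 else 0)"
  and form_root_root: "i \<le> rk D \<Longrightarrow> j \<le> rk D \<Longrightarrow> form D (root D i) (root D j) =
    of_nat (comark D i) / of_nat (mark D i) * of_int (cartan (atype D) i j)"
  and form_root_fweight0:
  "i \<le> rk D \<Longrightarrow> form D (root D i) (fweight D 0) = (if i = 0 then 1 / of_nat (mark D 0) else 0)"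
  and form_sym: "form D \<mu> \<nu> = form D \<nu> \<mu>"
  and form_fweight0: "form D (fweight D 0) (fweight D 0) = 0"
  using datum by (auto simp: is_affine_datum_def)

lemma roots: "inj_on (root D) {..rk D}" "independent (root D ` {..rk D})"
  and coroots: "inj_on (coroot D) {..rk D}" "independent (coroot D ` {..rk D})"
  and dims: "dim (UNIV :: 'h set) = rk D + 2" "dim (UNIV :: 'd set) = rk D + 2"
  and marks: "numerical_labels (rk D) (cartan (atype D)) (mark D)"
  and comarks: "numerical_labels (rk D) (\<lambda>i j. cartan (atype D) j i) (comark D)"
  and pair_bilinear: "bilinear (pair D)"
  and nondegenerate: "(\<And>x. pair D x \<mu> = 0) \<Longrightarrow> \<mu> = 0"
  and nondegenerate_left: "(\<And>\<mu>. pair D x \<mu> = 0) \<Longrightarrow> x = 0"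
  using datum by (auto simp: is_affine_datum_def)

lemma mark_0: "mark D 0 = 1"
proof (rule kernel_label_normalized[OF pair_bilinear nondegenerate coroots dims(1) roots pair_coroot_root marks])
  show "kac_label (atype D) 0 = 1"
    using valid not_A_even by (cases "atype D") auto
  show "(\<Sum>j\<le>rk D. cartan (atype D) i j * kac_label (atype D) j) = 0" if "i \<le> rk D" for i
    using affine_row_kac_label[OF valid not_A_even that] .
qed auto

text \<open>Comarks are marks of the dual type, with the pairing read in the opposite order.\<close>

lemma comark_0: "comark D 0 = 1"
proof (rule kernel_label_normalized[OF _ nondegenerate_left roots dims(2) coroots _ comarks])
  let ?Y = "dual_type (atype D)"
  have Y: "valid_type ?Y" "\<forall>n. ?Y \<noteq> Tw_A_even n"
    using valid not_A_even by (cases "atype D"; auto)+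
  show "kac_label ?Y 0 = 1"
    using Y by (cases ?Y) auto
  show "(\<Sum>j\<le>rk D. cartan (atype D) j i * kac_label ?Y j) = 0" if "i \<le> rk D" for i
    using affine_row_kac_label[OF Y, of i] cartan_dual_type[OF valid not_A_even] that by simp
  show "bilinear (\<lambda>\<mu> x. pair D x \<mu>)" using pair_bilinear by (simp add: bilinear_def)
qed (auto simp: pair_coroot_root)

lemma mark_pos: "i \<le> rk D \<Longrightarrow> 0 < mark D i"
  using marks by (simp add: numerical_labels_def)

lemma pair_coroot_null_root: "i \<le> rk D \<Longrightarrow> pair D (coroot D i) (null_root D) = 0"
proof -
  assume i: "i \<le> rk D"
  have "pair D (coroot D i) (null_root D)
      = of_int (\<Sum>j\<le>rk D. cartan (atype D) i j * int (mark D j))"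
    using i by (simp add: null_root_def linear_combination[OF linear_pair] pair_coroot_root mult.commute)
  moreover have "(\<Sum>j\<le>rk D. cartan (atype D) i j * int (mark D j)) = 0"
    using marks i by (simp add: numerical_labels_def)
  ultimately show ?thesis by (simp only: of_int_0)
qed

lemma pair_central: "pair D (central D) \<mu> = (\<Sum>i\<le>rk D. comark D i * pair D (coroot D i) \<mu>)"
  by (simp add: central_def linear_combination[OF linear_pair_left])

lemma pair_central_root: "j \<le> rk D \<Longrightarrow> pair D (central D) (root D j) = 0"
proof -
  assume j: "j \<le> rk D"
  have "pair D (central D) (root D j) = of_int (\<Sum>i\<le>rk D. cartan (atype D) i j * int (comark D i))"
    using j by (simp add: pair_central pair_coroot_root mult.commute)
  moreover have "(\<Sum>i\<le>rk D. cartan (atype D) i j * int (comark D i)) = 0"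
    using comarks j by (simp add: numerical_labels_def)
  ultimately show ?thesis by (simp only: of_int_0)
qed

lemma atMost_rk: "{..rk D} = insert 0 {1..rk D}"
  by auto

lemma pair_central_finite_dual:
  assumes "\<mu> \<in> finite_dual D"
  shows "pair D (central D) \<mu> = 0"
proof (rule linear_eq_0_on_span[OF linear_pair])
  show "\<mu> \<in> span (root D ` {1..rk D})" using assms by (simp add: finite_dual_def)
qed (auto intro: pair_central_root)

text \<open>Elements of the finite part have level 0, so with \<open>comark D 0 = 1\<close> the
  pairing with \<open>h\<^sub>0\<close> vanishes too and \<mu> is a multiple of the null root. The
  latter has coefficient 1 at \<open>\<alpha>\<^sub>0\<close>, whereas \<mu> has none.\<close>

lemma finite_dual_eq_0:
  assumes \<mu>: "\<mu> \<in> finite_dual D" and zero: "\<And>i. i \<in> {1..rk D} \<Longrightarrow> pair D (coroot D i) \<mu> = 0"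
  shows "\<mu> = 0"
proof -
  have "pair D (coroot D 0) \<mu> = 0"
    using pair_central_finite_dual[OF \<mu>] zero comark_0 unfolding pair_central atMost_rk by simp
  then have all: "pair D x \<mu> = 0" if "x \<in> coroot D ` {..rk D}" for x
    using that zero unfolding atMost_rk by auto
  have "null_root D \<noteq> 0"
  proof
    assume "null_root D = 0"
    then have "(\<Sum>i\<le>rk D. real (mark D i) *\<^sub>R root D i) = (\<Sum>i\<le>rk D. 0 *\<^sub>R root D i)"
      by (simp add: null_root_def)
    then have "real (mark D 0) = 0"
      by (rule independent_family_coefficients_unique[OF roots finite_atMost]) auto
    then show False using mark_0 by simp
  qed
  moreover have "Suc (card (coroot D ` {..rk D})) = dim (UNIV :: 'h set)"
    using coroots dims by (simp add: card_image)
  ultimately obtain t where t: "\<mu> = t *\<^sub>R null_root D"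
    using annihilator_of_hyperplane_is_line[OF pair_bilinear nondegenerate coroots(2), of "null_root D" \<mu>]
      pair_coroot_null_root all by auto
  have "inj_on (root D) {1..rk D}" using roots(1) by (rule inj_on_subset) auto
  then obtain c where c: "\<mu> = (\<Sum>i=1..rk D. c i *\<^sub>R root D i)"
    using span_finite_family[OF _ finite_atLeastAtMost] \<mu> unfolding finite_dual_def by blast
  have "(\<Sum>i\<le>rk D. (t * real (mark D i)) *\<^sub>R root D i) = \<mu>"
    by (simp add: t null_root_def scaleR_sum_right)
  also have "\<dots> = (\<Sum>i\<le>rk D. (c(0 := 0)) i *\<^sub>R root D i)"
    by (simp add: c atMost_rk)
  finally have "t * real (mark D 0) = (c(0 := 0)) 0"
    by (rule independent_family_coefficients_unique[OF roots finite_atMost]) auto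
  then show ?thesis using t mark_0 by simp
qed

lemma theta_eq: "theta D = (\<Sum>i=1..rk D. real (mark D i) *\<^sub>R root D i)"
  by (simp add: theta_def null_root_def atMost_rk)

lemma linear_proj: "linear (proj D)"
  by (rule linearI)
    (simp_all add: proj_def linear_add[OF linear_pair] linear_add[OF linear_form_left]
      linear_scale[OF linear_pair] linear_scale[OF linear_form_left] algebra_simps)

lemma proj_root_0: "proj D (root D 0) = - theta D"
  by (simp add: proj_def pair_central_root form_root_fweight0 mark_0 theta_def)

lemma proj_root: "i \<in> {1..rk D} \<Longrightarrow> proj D (root D i) = root D i"
  by (simp add: proj_def pair_central_root form_root_fweight0)

lemma pair_central_fweight: "i \<le> rk D \<Longrightarrow> pair D (central D) (fweight D i) = comark D i"
  by (simp add: pair_central pair_coroot_fweight if_distrib[of "(*) _"] cong: if_cong)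

lemma proj_fweight_0: "proj D (fweight D 0) = 0"
  by (simp add: proj_def pair_central_fweight comark_0 form_fweight0)

lemma theta_in_finite_dual: "theta D \<in> finite_dual D"
  unfolding theta_eq finite_dual_def by (intro span_sum span_scale span_base) auto

text \<open>\<open>\<Lambda>\<^sub>0\<close> has level 1 and all roots have level 0, so together
  with the simple roots it forms a basis, on which the projection is known.\<close>

lemma proj_in_finite_dual: "proj D \<mu> \<in> finite_dual D"
proof -
  let ?B = "insert (fweight D 0) (root D ` {..rk D})"
  have notin: "fweight D 0 \<notin> span (root D ` {..rk D})"
  proof
    assume "fweight D 0 \<in> span (root D ` {..rk D})"
    then have "pair D (central D) (fweight D 0) = 0"
      by (rule linear_eq_0_on_span[OF linear_pair, rotated]) (auto intro: pair_central_root)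
    then show False by (simp add: pair_central_fweight comark_0)
  qed
  then have "independent ?B" using roots(2) by (simp add: independent_insertI)
  moreover have "card ?B = dim (UNIV :: 'd set)"
    using notin roots(1) dims(2) span_base[of "fweight D 0" "root D ` {..rk D}"]
    by (subst card_insert_disjoint) (auto simp: card_image)
  ultimately have "span ?B = UNIV" by (intro span_eq_UNIV_if_card_eq_dim) (auto simp: dims)
  then have "proj D \<mu> \<in> span (proj D ` ?B)"
    using linear_span_image[OF linear_proj, of ?B] by auto
  moreover have "proj D ` ?B \<subseteq> finite_dual D"
    using theta_in_finite_dual proj_root span_base[of _ "root D ` {1..rk D}"]
    unfolding atMost_rk by (auto simp: proj_fweight_0 proj_root_0 finite_dual_def span_zero span_neg)
  ultimately show ?thesis
    using span_minimal[of "proj D ` ?B" "finite_dual D"] by (auto simp: finite_dual_def)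
qed

lemma pair_coroot_proj:
  "i \<in> {1..rk D} \<Longrightarrow> pair D (coroot D i) (proj D \<mu>) = pair D (coroot D i) \<mu>"
  by (simp add: proj_def linear_diff[OF linear_pair] linear_scale[OF linear_pair]
      pair_coroot_null_root pair_coroot_fweight)

lemma finite_root_latticeI: "(\<Sum>i=1..rk D. of_int (k i) *\<^sub>R root D i) \<in> finite_root_lattice D"
  unfolding finite_root_lattice_def by blast

lemma proj_root_lattice: "proj D ` root_lattice D = finite_root_lattice D"
proof -
  \<comment> \<open>The image of \<open>\<alpha>\<^sub>0\<close> is the negative of \<theta>, which
    shifts each coefficient by a multiple of its mark.\<close>
  have proj: "proj D (\<Sum>i\<le>rk D. of_int (k i) *\<^sub>R root D i)
      = (\<Sum>i=1..rk D. of_int (k i - k 0 * int (mark D i)) *\<^sub>R root D i)" for k :: "nat \<Rightarrow> int"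
  proof -
    have "proj D (\<Sum>i\<le>rk D. of_int (k i) *\<^sub>R root D i)
        = of_int (k 0) *\<^sub>R proj D (root D 0) + (\<Sum>i=1..rk D. of_int (k i) *\<^sub>R proj D (root D i))"
      unfolding linear_combination[OF linear_proj] atMost_rk by simp
    also have "(\<Sum>i=1..rk D. of_int (k i) *\<^sub>R proj D (root D i)) = (\<Sum>i=1..rk D. of_int (k i) *\<^sub>R root D i)"
      by (simp add: proj_root)
    finally show ?thesis
      by (simp add: proj_root_0 theta_eq scaleR_sum_right sum_subtractf scaleR_diff_left)
  qed
  show ?thesis
  proof
    show "proj D ` root_lattice D \<subseteq> finite_root_lattice D"
    proof (intro image_subsetI)
      fix \<mu> assume "\<mu> \<in> root_lattice D"
      then obtain k :: "nat \<Rightarrow> int" where "\<mu> = (\<Sum>i\<le>rk D. of_int (k i) *\<^sub>R root D i)"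
        unfolding root_lattice_def by auto
      then show "proj D \<mu> \<in> finite_root_lattice D"
        by (simp only: finite_root_latticeI proj)
    qed
    show "finite_root_lattice D \<subseteq> proj D ` root_lattice D"
    proof
      fix \<mu> assume "\<mu> \<in> finite_root_lattice D"
      then obtain k :: "nat \<Rightarrow> int" where "\<mu> = (\<Sum>i=1..rk D. of_int (k i) *\<^sub>R root D i)"
        unfolding finite_root_lattice_def by auto
      then have "\<mu> = proj D (\<Sum>i\<le>rk D. of_int ((k(0 := 0)) i) *\<^sub>R root D i)"
        unfolding proj by (simp cong: sum.cong_simp)
      then show "\<mu> \<in> proj D ` root_lattice D" unfolding root_lattice_def by blast
    qed
  qed
qed

text \<open>Both sides are linear and are compared on simple roots, where the marks in \<theta>
  cancel the denominators of the form. Thus \<theta> represents the central element without its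
  \<open>h\<^sub>0\<close> term.\<close>

lemma form_theta:
  assumes "\<mu> \<in> finite_dual D"
  shows "form D \<mu> (theta D) = (\<Sum>i=1..rk D. comark D i * pair D (coroot D i) \<mu>)"
proof (rule linear_eq_on_span[of "\<lambda>\<mu>. form D \<mu> (theta D)"])
  show "\<mu> \<in> span (root D ` {1..rk D})" using assms by (simp add: finite_dual_def)
  show "linear (\<lambda>\<mu>. \<Sum>i=1..rk D. comark D i * pair D (coroot D i) \<mu>)"
    by (rule linearI) (simp_all add: linear_add[OF linear_pair] linear_scale[OF linear_pair]
        sum.distrib distrib_left sum_distrib_left mult.left_commute)
  fix \<nu> assume "\<nu> \<in> root D ` {1..rk D}"
  then obtain j where j: "\<nu> = root D j" "j \<in> {1..rk D}" by auto
  have "form D \<nu> (theta D) = (\<Sum>i=1..rk D. real (mark D i) * form D (root D i) (root D j))"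
    unfolding theta_eq j(1) by (simp add: linear_combination[OF linear_form] form_sym[of "root D j"])
  also have "\<dots> = (\<Sum>i=1..rk D. comark D i * pair D (coroot D i) \<nu>)"
    using j mark_pos by (intro sum.cong) (auto simp: form_root_root pair_coroot_root less_imp_neq)
  finally show "form D \<nu> (theta D) = (\<Sum>i=1..rk D. comark D i * pair D (coroot D i) \<nu>)" .
qed (rule linear_form_left)

lemma pair_coroot_fweight_sum:
  assumes "j \<le> rk D"
  shows "pair D (coroot D j) (\<Sum>i\<le>rk D. c i *\<^sub>R fweight D i) = c j"
proof -
  have "pair D (coroot D j) (\<Sum>i\<le>rk D. c i *\<^sub>R fweight D i) = (\<Sum>i\<le>rk D. if i = j then c i else 0)"
    unfolding linear_combination[OF linear_pair]
    using assms by (intro sum.cong) (auto simp: pair_coroot_fweight)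
  then show ?thesis using assms by simp
qed

lemma pair_coroot_dominant:
  assumes "\<mu> \<in> dominant_level D l" "i \<le> rk D"
  shows "pair D (coroot D i) \<mu> \<in> \<int>"
  using assms by (auto simp: dominant_level_def pair_coroot_fweight_sum)

text \<open>Against \<theta> the projection takes the value \<open>l - comark D 0 * m 0\<close>, so
  the upper wall expresses that \<open>m 0\<close> is nonnegative.\<close>

lemma proj_dominant_in_alcove:
  assumes "\<mu> \<in> dominant_level D l"
  shows "proj D \<mu> \<in> alcove D l"
proof -
  obtain m :: "nat \<Rightarrow> nat" where m: "\<mu> = (\<Sum>i\<le>rk D. of_nat (m i) *\<^sub>R fweight D i)"
    "(\<Sum>i\<le>rk D. comark D i * m i) = l"
    using assms by (auto simp: dominant_level_def)
  then have pair: "pair D (coroot D i) (proj D \<mu>) = m i" if "i \<in> {1..rk D}" for i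
    using that by (simp add: pair_coroot_proj pair_coroot_fweight_sum)
  have "form D (proj D \<mu>) (theta D) = real (\<Sum>i=1..rk D. comark D i * m i)"
    by (simp add: form_theta[OF proj_in_finite_dual] pair)
  also have "\<dots> \<le> l" unfolding m(2)[symmetric] atMost_rk by simp
  finally show ?thesis by (simp add: alcove_def proj_in_finite_dual pair)
qed

lemma finite_root_lattice_diff:
  assumes "\<mu> \<in> finite_root_lattice D" "\<nu> \<in> finite_root_lattice D"
  shows "\<mu> - \<nu> \<in> finite_root_lattice D"
proof -
  obtain k k' :: "nat \<Rightarrow> int" where "\<mu> = (\<Sum>i=1..rk D. of_int (k i) *\<^sub>R root D i)"
    "\<nu> = (\<Sum>i=1..rk D. of_int (k' i) *\<^sub>R root D i)"
    using assms by (auto simp: finite_root_lattice_def)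
  then have "\<mu> - \<nu> = (\<Sum>i=1..rk D. of_int (k i - k' i) *\<^sub>R root D i)"
    by (simp add: sum_subtractf scaleR_diff_left)
  then show ?thesis using finite_root_latticeI by metis
qed

section \<open>The quotient of the finite weight lattice by the root lattice\<close>

lemma finite_root_lattice_iff:
  assumes \<mu>: "\<mu> \<in> finite_weight_lattice D"
  shows "\<mu> \<in> finite_root_lattice D \<longleftrightarrow>
    (\<exists>x. \<forall>i\<in>{1..rk D}. \<lfloor>pair D (coroot D i) \<mu>\<rfloor> = (\<Sum>j=1..rk D. cartan (atype D) i j * x j))"
    (is "_ \<longleftrightarrow> (\<exists>x. \<forall>i\<in>_. ?k i = ?row x i)")
proof -
  have pair: "pair D (coroot D i) (\<Sum>j=1..rk D. of_int (x j) *\<^sub>R root D j) = of_int (?row x i)"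
    if "i \<in> {1..rk D}" for i x
    using that by (simp add: linear_combination[OF linear_pair] pair_coroot_root mult.commute)
  show ?thesis
  proof
    assume "\<mu> \<in> finite_root_lattice D"
    then obtain x :: "nat \<Rightarrow> int" where \<mu>x: "\<mu> = (\<Sum>j=1..rk D. of_int (x j) *\<^sub>R root D j)"
      by (auto simp: finite_root_lattice_def)
    then have "?k i = ?row x i" if "i \<in> {1..rk D}" for i
      using pair[OF that, of x] by (metis floor_of_int \<mu>x)
    then show "\<exists>x. \<forall>i\<in>{1..rk D}. ?k i = ?row x i" by blast
  next
    assume "\<exists>x. \<forall>i\<in>{1..rk D}. ?k i = ?row x i"
    then obtain x where x: "\<And>i. i \<in> {1..rk D} \<Longrightarrow> ?k i = ?row x i" by blast
    let ?\<nu> = "\<Sum>j=1..rk D. of_int (x j) *\<^sub>R root D j"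
    \<comment> \<open>Agreement of all finite coordinates suffices, since they separate the points
      of the finite part.\<close>
    have "\<mu> - ?\<nu> = 0"
    proof (rule finite_dual_eq_0)
      have "?\<nu> \<in> finite_dual D"
        unfolding finite_dual_def by (intro span_sum span_scale span_base) auto
      then show "\<mu> - ?\<nu> \<in> finite_dual D"
        using \<mu> by (auto simp: finite_weight_lattice_def finite_dual_def intro: span_diff)
      fix i assume i: "i \<in> {1..rk D}"
      then have "pair D (coroot D i) \<mu> \<in> \<int>" using \<mu> by (simp add: finite_weight_lattice_def)
      then have "pair D (coroot D i) \<mu> = of_int (?k i)" by (simp add: of_int_floor)
      then show "pair D (coroot D i) (\<mu> - ?\<nu>) = 0"
        using x[OF i] pair[OF i, of x] by (simp add: linear_diff[OF linear_pair])
    qed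
    then show "\<mu> \<in> finite_root_lattice D" unfolding finite_root_lattice_def by auto
  qed
qed

text \<open>On the finite weight lattice this is a complete invariant of cosets of the root
  lattice.\<close>

definition residues :: "'d \<Rightarrow> int list" where
  "residues \<mu> = map (\<lambda>x. x mod int (weight_index (atype D))) (ev_S D \<mu>)"

lemma finite_root_lattice_diff_iff_residues:
  assumes \<mu>: "\<mu> \<in> finite_weight_lattice D" and \<nu>: "\<nu> \<in> finite_weight_lattice D"
  shows "\<mu> - \<nu> \<in> finite_root_lattice D \<longleftrightarrow> residues \<mu> = residues \<nu>"
proof -
  let ?k = "\<lambda>\<mu> i. \<lfloor>pair D (coroot D i) \<mu>\<rfloor>"
  have int: "pair D (coroot D i) \<mu> \<in> \<int>" "pair D (coroot D i) \<nu> \<in> \<int>" if "i \<in> {1..rk D}" for i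
    using \<mu> \<nu> that by (auto simp: finite_weight_lattice_def)
  then have k: "?k (\<mu> - \<nu>) i = ?k \<mu> i - ?k \<nu> i" if "i \<in> {1..rk D}" for i
    using that[THEN int(1)] that[THEN int(2)] by (auto simp: linear_diff[OF linear_pair] elim!: Ints_cases)
  have diff: "\<mu> - \<nu> \<in> finite_weight_lattice D"
    using \<mu> \<nu> unfolding finite_weight_lattice_def finite_dual_def
    by (simp add: span_diff linear_diff[OF linear_pair])
  have sum: "(\<Sum>i=1..rk D. s i * ?k (\<mu> - \<nu>) i) = (\<Sum>i=1..rk D. s i * ?k \<mu> i) - (\<Sum>i=1..rk D. s i * ?k \<nu> i)"
    for s
    using k by (simp add: right_diff_distrib sum_subtractf)
  show ?thesis
    unfolding finite_root_lattice_iff[OF diff] root_coordinates_iff[OF valid not_A_even] sum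
    by (simp add: residues_def ev_S_def mod_eq_dvd_iff)
qed

lemma proj_in_finite_weight_lattice:
  assumes "\<And>i. i \<in> {1..rk D} \<Longrightarrow> pair D (coroot D i) \<mu> \<in> \<int>"
  shows "proj D \<mu> \<in> finite_weight_lattice D"
  using assms by (simp add: finite_weight_lattice_def proj_in_finite_dual pair_coroot_proj)

lemma ev_S_proj: "ev_S D (proj D \<mu>) = ev_S D \<mu>"
  by (simp add: ev_S_def pair_coroot_proj)

text \<open>Cosets correspond to values of \<open>residues\<close>, which have been counted over all
  integer coordinate vectors.\<close>

lemma fundamental_index_eq: "fundamental_index D = weight_index (atype D)"
proof -
  let ?F = "\<lambda>k :: nat \<Rightarrow> int. map (\<lambda>s. (\<Sum>i=1..rk D. s i * k i) mod int (weight_index (atype D)))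
    (sieving_set (atype D))"
  have "residues ` finite_weight_lattice D = range ?F"
  proof
    show "residues ` finite_weight_lattice D \<subseteq> range ?F"
      by (auto simp: residues_def ev_S_def)
    show "range ?F \<subseteq> residues ` finite_weight_lattice D"
    proof
      fix v assume "v \<in> range ?F"
      then obtain k where k: "v = ?F k" by blast
      \<comment> \<open>Every coordinate vector occurs in the weight lattice, because the projection
        preserves pairings with the finite coroots.\<close>
      let ?\<mu> = "\<Sum>i\<le>rk D. of_int (k i) *\<^sub>R fweight D i"
      have "proj D ?\<mu> \<in> finite_weight_lattice D"
        by (rule proj_in_finite_weight_lattice) (simp add: pair_coroot_fweight_sum)
      moreover have "residues (proj D ?\<mu>) = v"
        unfolding k residues_def ev_S_proj by (simp add: ev_S_def pair_coroot_fweight_sum)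
      ultimately show "v \<in> residues ` finite_weight_lattice D" by blast
    qed
  qed
  then have "card (residues ` finite_weight_lattice D) = weight_index (atype D)"
    using card_residues[OF valid not_A_even] by simp
  moreover have "{(\<mu>, \<nu>). \<mu> \<in> finite_weight_lattice D \<and> \<nu> \<in> finite_weight_lattice D \<and>
      \<mu> - \<nu> \<in> finite_root_lattice D}
    = {(\<mu>, \<nu>). \<mu> \<in> finite_weight_lattice D \<and> \<nu> \<in> finite_weight_lattice D \<and> residues \<mu> = residues \<nu>}"
    using finite_root_lattice_diff_iff_residues by auto
  ultimately show ?thesis
    unfolding fundamental_index_def by (simp add: card_quotient_kernel)
qed

section \<open>The sieving equivalence\<close>

text \<open>The projection of \<nu> lies in the alcove, so its coset meets the alcove and equal
  intersections force equal cosets; two distinct cosets cannot agree by both missing it.\<close>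

lemma sieving_equiv_iff:
  assumes \<nu>: "\<nu> \<in> dominant_level D l"
  shows "sieving_equiv D l \<mu> \<nu> \<longleftrightarrow> proj D \<nu> - proj D \<mu> \<in> finite_root_lattice D"
proof -
  have coset: "{proj D \<mu> + \<beta> | \<beta>. \<beta> \<in> proj D ` root_lattice D}
      = {\<kappa>. \<kappa> - proj D \<mu> \<in> finite_root_lattice D}" for \<mu>
    by (force simp: proj_root_lattice)
  have zero: "0 \<in> finite_root_lattice D"
    by (auto simp: finite_root_lattice_def intro!: exI[of _ "\<lambda>_. 0"])
  show ?thesis
  proof
    assume "sieving_equiv D l \<mu> \<nu>"
    moreover have "proj D \<nu> \<in> alcove D l \<inter> {\<kappa>. \<kappa> - proj D \<nu> \<in> finite_root_lattice D}"
      using proj_dominant_in_alcove[OF \<nu>] zero by simp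
    ultimately have "proj D \<nu> \<in> alcove D l \<inter> {\<kappa>. \<kappa> - proj D \<mu> \<in> finite_root_lattice D}"
      unfolding sieving_equiv_def coset by (rule ssubst)
    then show "proj D \<nu> - proj D \<mu> \<in> finite_root_lattice D" by simp
  next
    assume diff: "proj D \<nu> - proj D \<mu> \<in> finite_root_lattice D"
    have "\<kappa> - proj D \<mu> \<in> finite_root_lattice D \<longleftrightarrow> \<kappa> - proj D \<nu> \<in> finite_root_lattice D" for \<kappa>
    proof
      assume "\<kappa> - proj D \<mu> \<in> finite_root_lattice D"
      from finite_root_lattice_diff[OF this diff]
      show "\<kappa> - proj D \<nu> \<in> finite_root_lattice D" by simp
    next
      assume "\<kappa> - proj D \<nu> \<in> finite_root_lattice D"
      from finite_root_lattice_diff[OF this finite_root_lattice_diff[OF zero diff]]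
      show "\<kappa> - proj D \<mu> \<in> finite_root_lattice D" by simp
    qed
    then show "sieving_equiv D l \<mu> \<nu>" unfolding sieving_equiv_def coset by simp
  qed
qed

lemma sieving_class_eq:
  assumes \<mu>: "\<And>i. i \<in> {1..rk D} \<Longrightarrow> pair D (coroot D i) \<mu> \<in> \<int>"
  shows "sieving_class D l \<mu> = {\<nu> \<in> dominant_level D l.
    list_all2 (\<lambda>x y. [x = y] (mod int (fundamental_index D))) (ev_S D \<nu>) (ev_S D \<mu>)}"
proof -
  have "sieving_equiv D l \<mu> \<nu> \<longleftrightarrow>
      list_all2 (\<lambda>x y. [x = y] (mod int (fundamental_index D))) (ev_S D \<nu>) (ev_S D \<mu>)"
    if \<nu>: "\<nu> \<in> dominant_level D l" for \<nu>
  proof -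
    have "sieving_equiv D l \<mu> \<nu> \<longleftrightarrow> residues (proj D \<nu>) = residues (proj D \<mu>)"
      unfolding sieving_equiv_iff[OF \<nu>]
      using \<mu> pair_coroot_dominant[OF \<nu>]
      by (intro finite_root_lattice_diff_iff_residues proj_in_finite_weight_lattice) auto
    also have "\<dots> \<longleftrightarrow>
        list_all2 (\<lambda>x y. [x = y] (mod int (fundamental_index D))) (ev_S D \<nu>) (ev_S D \<mu>)"
      unfolding residues_def ev_S_proj fundamental_index_eq cong_def
      by (simp add: list.rel_eq[symmetric] list_all2_map1 list_all2_map2)
    finally show ?thesis .
  qed
  then show ?thesis by (auto simp: sieving_class_def)
qed

end

lemma distinguished_index_le_rank:
  "valid_type X \<Longrightarrow> i \<in> distinguished_indices X \<Longrightarrow> i \<le> rank X"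
  by (cases X) auto

theorem theorem2p14:
  fixes D :: "('h::real_vector, 'd::real_vector) affine_datum"
    and l i :: nat and \<Lambda> :: 'd
  assumes "is_affine_datum D"
    and "\<forall>n. atype D \<noteq> Tw_A_even n"
    and "i \<in> distinguished_indices (atype D)"
    and "i \<noteq> 0 \<longrightarrow> 1 \<le> l"
    and "\<Lambda> = (real l - 1) *\<^sub>R fweight D 0 + fweight D i"
  shows "sieving_class D l \<Lambda> =
    {\<Lambda>' \<in> dominant_level D l.
       list_all2 (\<lambda>x y. [x = y] (mod int (fundamental_index D))) (ev_S D \<Lambda>') (ev_S D \<Lambda>)}"
proof -
  interpret affine_realization D
    using assms by unfold_locales
  have "i \<le> rk D" using distinguished_index_le_rank[OF valid assms(3)] .
  \<comment> \<open>The multiple of \<open>\<Lambda>\<^sub>0\<close> is invisible to the finite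
    coroots, so the coordinates of \<Lambda> are 0 or 1 for every level.\<close>
  then have "pair D (coroot D j) \<Lambda> \<in> \<int>" if "j \<in> {1..rk D}" for j
    using that unfolding assms(5)
    by (simp add: linear_add[OF linear_pair] linear_scale[OF linear_pair] pair_coroot_fweight)
  then show ?thesis by (rule sieving_class_eq)
qed

end
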